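(* For $k\in\mathbb{N}$ and $\tau\in\mathbb{H}$ let $$\mathbb F_k(\tau):=\frac12 \sum_{\bm n\in\mathbb{Z}^2+\left(0,\frac 12\right)} (-1)^{n_1}\,\mathrm{sgn}(n_1)\,\mathrm{sgn}\left(n_2\right)q^{\frac{n_1^2}{2}+n_1n_2+(k+1)n_2^2}\qquad(q=e^{2\pi i\tau}).$$ Then $$\frac{2\, \mathbb F_k(\tau) }{\sqrt{2k+1}} = \int_{\tau}^{\tau+i\infty} \frac{\eta((2k+1)w_1)^3}{\sqrt{i(w_1-\tau)}} \int_{\tau}^{w_1}\frac{\eta(w_2)^3}{\sqrt{i(w_2-\tau)}}\,dw_2\,dw_1$$ $$+\,2(k+1) \sum_{j=0}^{2k+1}(-1)^{j} \int_{\tau}^{\tau+ i \infty} \frac{ \vartheta^{[1]}_{k+1,j}((2k+1)w_1)}{\sqrt{i(w_1-\tau)}}\int_{\tau}^{w_1} \frac{\vartheta^{[1]}_{k+1,j+k+1}(w_2)}{\sqrt{i(w_2-\tau)}}\,dw_2\,dw_1.$$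
   Context: $\mathbb{H}$ is the upper half-plane. $\mathrm{sgn}(x)=x/|x|$ for $x\neq0$, $\mathrm{sgn}(0)=0$. $\eta(\tau)=q^{1/24}\prod_{n\ge1}(1-q^n)$. For $m\in\mathbb{Z}_{>0}$, $r\in\mathbb{Z}$: $\vartheta_{m,r}^{[1]}(\tau)=\sum_{n\in\mathbb{Z}+\frac{r}{2m}}n\, q^{mn^2}$. Square roots are principal; integrals are along the vertical path from $\tau$ to $i\infty$ ($w_2$ along the part of it from $\tau$ to $w_1$). *)

theory Defs
  imports "HOL-Complex_Analysis.Complex_Analysis"
begin

text \<open>\<open>qpow \<tau> x\<close> is \<open>q\<^sup>x\<close> for \<open>q = exp (2 \<pi> \<i> \<tau>)\<close>; for fractional \<open>x\<close> the branch is the one given by \<open>\<tau>\<close>.\<close>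

definition qpow :: "complex \<Rightarrow> real \<Rightarrow> complex" where
  "qpow \<tau> x = exp (2 * of_real pi * \<i> * of_real x * \<tau>)"

definition dedekind_eta :: "complex \<Rightarrow> complex" where
  "dedekind_eta \<tau> = qpow \<tau> (1/24) * (\<Prod>n. 1 - qpow \<tau> 1 ^ Suc n)"

definition theta1 :: "nat \<Rightarrow> int \<Rightarrow> complex \<Rightarrow> complex" where
  "theta1 m r \<tau> =
     (\<Sum>\<^sub>\<infinity>n \<in> range (\<lambda>l::int. real_of_int l + real_of_int r / (2 * real m)).
        of_real n * qpow \<tau> (real m * n\<^sup>2))"

definition FF :: "nat \<Rightarrow> complex \<Rightarrow> complex" where
  "FF k \<tau> = 1/2 *
     (\<Sum>\<^sub>\<infinity>(n1, n2) \<in> (UNIV :: int set) \<times> range (\<lambda>l::int. real_of_int l + 1/2).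
        (-1) powi n1 * of_int (sgn n1) * of_real (sgn n2) *
        qpow \<tau> ((real_of_int n1)\<^sup>2 / 2 + real_of_int n1 * n2 + (real k + 1) * n2\<^sup>2))"

text \<open>The integral of \<open>f\<close> along the vertical half-line from \<open>\<tau>\<close> to \<open>\<tau> + \<i>\<infinity>\<close>, parametrised
  by \<open>w = \<tau> + \<i> t\<close>. The Henstock--Kurzweil integral covers both the improper upper limit and an
  integrable singularity at \<open>w = \<tau>\<close>.\<close>

definition vertical_integral :: "complex \<Rightarrow> (complex \<Rightarrow> complex) \<Rightarrow> complex" where
  "vertical_integral \<tau> f = integral {0..} (\<lambda>t::real. f (\<tau> + \<i> * of_real t) * \<i>)"

text \<open>On the vertical path \<open>\<i> (w - \<tau>)\<close> is a negative real, so it lies on the cut of the principal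
  root, where \<open>csqrt\<close> takes the value with argument \<open>\<pi>/2\<close>; both roots lie on the same side of the
  cut, so their product does not depend on that choice.\<close>

definition iterated_integral ::
    "(complex \<Rightarrow> complex) \<Rightarrow> (complex \<Rightarrow> complex) \<Rightarrow> complex \<Rightarrow> complex" where
  "iterated_integral f g \<tau> =
     vertical_integral \<tau> (\<lambda>w1. f w1 / csqrt (\<i> * (w1 - \<tau>)) *
       contour_integral (linepath \<tau> w1) (\<lambda>w2. g w2 / csqrt (\<i> * (w2 - \<tau>))))"

end

theory Submission
  imports Defs
begin

text \<open>On the vertical path both square roots are purely imaginary and cancel against
  \<open>dw = \<i> dt\<close>; substituting \<open>t\<^sub>2 = t\<^sub>1 v\<^sup>2\<close> removes the
  singularities. For theta series \<open>\<Sum> N q\<^bsup>c N\<^sup>2\<^esup>\<close> and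
  \<open>\<Sum> M q\<^bsup>d M\<^sup>2\<^esup>\<close> the iterated integral can then be computed
  termwise, and the pair \<open>(N, M)\<close> contributes
  \<open>arctan (sqrt (d / c) M / N) / (\<pi> sqrt (c d)) q\<^bsup>c N\<^sup>2 + d M\<^sup>2\<^esup>\<close>.
  Since \<open>\<eta>\<^sup>3\<close> is such a series by Jacobi's identity, both terms on the right-hand side
  become sums over the index set of \<open>F\<^sub>k\<close> with the same quadratic form. With
  \<open>s = sqrt (2 k + 1)\<close> the two arctangents belonging to \<open>(n\<^sub>1, n\<^sub>2)\<close> add up to
  \<open>\<pi> / 2 sgn n\<^sub>1 sgn n\<^sub>2 + arctan (1 / s)\<close>, and the constant
  \<open>arctan (1 / s)\<close> contributes nothing because
  \<open>\<Sum> (-1)\<^bsup>n\<^sub>1\<^esup> q\<^bsup>Q(n)\<^esup>\<close> is odd under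
  \<open>n\<^sub>1 \<mapsto> - n\<^sub>1 - 2 n\<^sub>2\<close>.\<close>

subsection \<open>Termwise summation and integration\<close>

text \<open>Absolute convergence of both factors carries over to the double family, which may then
  be summed by rows. The first part also supplies the majorant when sums and integrals are
  exchanged.\<close>

lemma has_sum_prod_abs:
  fixes f :: "'a \<Rightarrow> complex" and g :: "'b \<Rightarrow> complex"
  assumes "(\<lambda>x. norm (f x)) summable_on S" "(\<lambda>y. norm (g y)) summable_on T"
  shows "(\<lambda>(x, y). norm (f x * g y)) summable_on S \<times> T"
    and "((\<lambda>(x, y). f x * g y) has_sum (\<Sum>\<^sub>\<infinity>x\<in>S. f x) * (\<Sum>\<^sub>\<infinity>y\<in>T. g y)) (S \<times> T)"
proof -
  have f: "(f has_sum (\<Sum>\<^sub>\<infinity>x\<in>S. f x)) S" and g: "(g has_sum (\<Sum>\<^sub>\<infinity>y\<in>T. g y)) T"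
    using assms[THEN abs_summable_summable] by auto
  have nf: "((\<lambda>x. norm (f x)) has_sum (\<Sum>\<^sub>\<infinity>x\<in>S. norm (f x))) S"
    and ng: "((\<lambda>x. norm (g x)) has_sum (\<Sum>\<^sub>\<infinity>x\<in>T. norm (g x))) T"
    using assms by auto
  show s: "(\<lambda>(x, y). norm (f x * g y)) summable_on S \<times> T"
    unfolding case_prod_unfold norm_mult
    by (rule summable_on_SigmaI[where g = "\<lambda>x. norm (f x) * (\<Sum>\<^sub>\<infinity>x\<in>T. norm (g x))"])
       (auto intro!: has_sum_cmult_right ng summable_on_cmult_left assms(1))
  show "((\<lambda>(x, y). f x * g y) has_sum (\<Sum>\<^sub>\<infinity>x\<in>S. f x) * (\<Sum>\<^sub>\<infinity>y\<in>T. g y)) (S \<times> T)"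
    by (rule has_sum_SigmaI[where g = "\<lambda>x. f x * (\<Sum>\<^sub>\<infinity>y\<in>T. g y)"])
       (use s in \<open>auto intro!: has_sum_cmult_right has_sum_cmult_left f g abs_summable_summable
          simp: case_prod_unfold\<close>)
qed

text \<open>The exchange rests on \<open>sums_integral\<close>, which treats series over all of
  \<open>nat\<close> and integrals over the whole line; therefore \<open>H\<close> extends
  \<open>h\<close> by zero outside \<open>P\<close> and \<open>X\<close>. At the end the Lebesgue
  integral of the sum is read as a gauge integral, the notion behind
  \<open>vertical_integral\<close>.\<close>

lemma has_sum_integral_nat:
  fixes h :: "nat \<Rightarrow> real \<Rightarrow> complex"
  assumes int: "\<And>p. p \<in> P \<Longrightarrow> set_integrable lborel X (h p)"
    and sumint: "(\<lambda>p. LINT x:X|lborel. norm (h p x)) summable_on P"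
    and ptw: "\<And>x. x \<in> X \<Longrightarrow> (\<lambda>p. norm (h p x)) summable_on P"
  shows "((\<lambda>p. LINT x:X|lborel. h p x) has_sum integral X (\<lambda>x. \<Sum>\<^sub>\<infinity>p\<in>P. h p x)) P"
proof -
  define H where "H p x = (if p \<in> P then indicator X x *\<^sub>R h p x else 0)" for p x
  have I: "integrable lborel (H p)" for p
    using int[of p] by (cases "p \<in> P") (auto simp: H_def[abs_def] set_integrable_def)
  have nH: "(\<integral>x. norm (H p x) \<partial>lborel) = (if p \<in> P then LINT x:X|lborel. norm (h p x) else 0)" for p
    by (auto simp: H_def set_lebesgue_integral_def abs_mult)
  have sH: "(\<lambda>p. norm (H p x)) summable_on UNIV" for x
  proof (cases "x \<in> X")
    case True
    show ?thesis
      using ptw[OF True] by (rule summable_on_cong_neutral[THEN iffD1, rotated -1])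
        (use True in \<open>auto simp: H_def\<close>)
  qed (simp add: H_def cong: if_cong)
  have sI: "(\<lambda>p. \<integral>x. norm (H p x) \<partial>lborel) summable_on UNIV"
    unfolding nH using sumint
    by (rule summable_on_cong_neutral[THEN iffD1, rotated -1]) auto
  have sum_eq: "(\<Sum>p. H p x) = indicator X x *\<^sub>R (\<Sum>\<^sub>\<infinity>p\<in>P. h p x)" for x
  proof -
    have "(\<Sum>p. H p x) = (\<Sum>\<^sub>\<infinity>p. H p x)"
      using has_sum_imp_sums[OF has_sum_infsum[OF abs_summable_summable[OF sH[of x]]]]
      by (simp add: sums_iff)
    also have "\<dots> = (\<Sum>\<^sub>\<infinity>p\<in>P. indicator X x *\<^sub>R h p x)"
      by (rule infsum_cong_neutral) (auto simp: H_def)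
    also have "\<dots> = indicator X x *\<^sub>R (\<Sum>\<^sub>\<infinity>p\<in>P. h p x)"
      by (auto simp: indicator_def)
    finally show ?thesis .
  qed
  have A1: "AE x in lborel. summable (\<lambda>i. norm (H i x))"
    using sH by (auto intro: summable_on_imp_summable)
  have A2: "summable (\<lambda>i. \<integral>x. norm (H i x) \<partial>lborel)"
    using sI by (rule summable_on_imp_summable)
  note S = integrable_suminf[OF I A1 A2] sums_integral[OF I A1 A2]
  have si: "set_integrable lborel X (\<lambda>x. \<Sum>\<^sub>\<infinity>p\<in>P. h p x)"
    using S(1) unfolding sum_eq set_integrable_def .
  have "((\<lambda>p. integral\<^sup>L lborel (H p)) has_sum (\<integral>x. (\<Sum>i. H i x) \<partial>lborel)) UNIV"
  proof (rule norm_summable_imp_has_sum[OF _ S(2)])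
    show "summable (\<lambda>n. norm (integral\<^sup>L lborel (H n)))"
      by (rule summable_comparison_test[OF _ A2]) (auto intro!: exI[of _ 0] integral_norm_bound)
  qed
  also have "(\<integral>x. (\<Sum>i. H i x) \<partial>lborel) = integral X (\<lambda>x. \<Sum>\<^sub>\<infinity>p\<in>P. h p x)"
    using set_borel_integral_eq_integral(2)[OF si] unfolding sum_eq set_lebesgue_integral_def .
  finally show ?thesis
    by (rule has_sum_cong_neutral[THEN iffD1, rotated -1])
       (auto simp: H_def[abs_def] set_lebesgue_integral_def)
qed

lemma has_sum_integral_countable:
  fixes h :: "'p::countable \<Rightarrow> real \<Rightarrow> complex"
  assumes int: "\<And>p. p \<in> P \<Longrightarrow> set_integrable lborel X (h p)"
    and sumint: "(\<lambda>p. LINT x:X|lborel. norm (h p x)) summable_on P"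
    and ptw: "\<And>x. x \<in> X \<Longrightarrow> (\<lambda>p. norm (h p x)) summable_on P"
  shows "((\<lambda>p. LINT x:X|lborel. h p x) has_sum integral X (\<lambda>x. \<Sum>\<^sub>\<infinity>p\<in>P. h p x)) P"
proof -
  have inj: "inj_on (to_nat :: 'p \<Rightarrow> nat) P" by (rule inj_on_subset[OF inj_to_nat]) simp
  have *: "((\<lambda>p. LINT x:X|lborel. h (from_nat p) x) has_sum
      integral X (\<lambda>x. \<Sum>\<^sub>\<infinity>p\<in>to_nat ` P. h (from_nat p) x)) (to_nat ` P)"
    by (rule has_sum_integral_nat)
       (use assms in \<open>auto simp: summable_on_reindex[OF inj] o_def\<close>)
  show ?thesis
    using * by (simp add: has_sum_reindex[OF inj] infsum_reindex[OF inj] o_def)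
qed

subsection \<open>Iterated integrals\<close>

text \<open>The positive function exp (-2 pi (A + B v^2) t) is integrated over 0 \<le> v \<le> 1, t
  \<ge> 0 in both orders: over v first it gives \<open>E\<close>, over t first 1 / (2 pi (A + B
  v^2)). Since \<open>A > 0\<close>, the latter is continuous on the unit interval, which yields
  integrability on the strip.\<close>

lemma exp_kernel:
  fixes A B :: real
  assumes A: "A > 0" and B: "B \<ge> 0"
  defines "E \<equiv> (\<lambda>t::real. exp (-2 * pi * A * t) * (LINT v:{0..1}|lborel. exp (-2 * pi * B * t * v\<^sup>2)))"
  shows "set_integrable lborel {0..} E"
    and "(LINT t:{0..}|lborel. E t) = (LINT v:{0..1}|lborel. 1 / (2 * pi * (A + B * v\<^sup>2)))"
proof -
  define f where "f = (\<lambda>(v::real, t::real). indicator {0..1} v * (indicator {0..} t *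
      exp (-2 * pi * (A + B * v\<^sup>2) * t)) :: real)"
  have meas: "f \<in> borel_measurable (lborel \<Otimes>\<^sub>M lborel)"
    unfolding f_def case_prod_unfold by measurable
  have pos: "0 < 2 * pi * (A + B * v\<^sup>2)" for v using A B by (simp add: add_pos_nonneg)
  have hb: "has_bochner_integral lborel (\<lambda>t. indicator {0..} t * exp (-2 * pi * (A + B * v\<^sup>2) * t))
      (1 / (2 * pi * (A + B * v\<^sup>2)))" for v
  proof -
    have "((\<lambda>t. exp (- (2 * pi * (A + B * v\<^sup>2)) * t)) has_integral
        exp (- (2 * pi * (A + B * v\<^sup>2)) * 0) / (2 * pi * (A + B * v\<^sup>2))) {0..}"
      by (rule has_integral_exp_minus_to_infinity[OF pos])
    hence "((\<lambda>t. exp (- (2 * pi * (A + B * v\<^sup>2)) * t)) has_integral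
        1 / (2 * pi * (A + B * v\<^sup>2))) {0..}" by simp
    moreover have "0 \<le> 1 / (2 * pi * (A + B * v\<^sup>2))" using pos[of v] by simp
    ultimately have "has_bochner_integral lborel (\<lambda>t. indicator {0..} t * exp (- (2 * pi * (A + B * v\<^sup>2)) * t))
      (1 / (2 * pi * (A + B * v\<^sup>2)))"
      by (intro has_bochner_integral_nn_integral nn_integral_has_integral_lebesgue)
         (auto intro!: nn_integral_has_integral_lborel simp: indicator_def)
    thus ?thesis by simp
  qed
  have hbI: "integrable lborel (\<lambda>t. f (v, t))" "(\<integral>t. f (v, t) \<partial>lborel) = indicator {0..1} v *\<^sub>R (1 / (2 * pi * (A + B * v\<^sup>2)))" for v
    using hb[of v] by (auto simp: f_def has_bochner_integral_iff)
  have nf: "norm (f z) = f z" for z by (auto simp: f_def case_prod_unfold)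
  have cont: "set_integrable lborel {0..1} (\<lambda>v. 1 / (2 * pi * (A + B * v\<^sup>2)))"
    using pos by (intro borel_integrable_atLeastAtMost' continuous_intros) (metis less_irrefl)
  have If: "integrable (lborel \<Otimes>\<^sub>M lborel) f"
    by (rule lborel_pair.Fubini_integrable[OF meas])
       (use cont in \<open>auto simp: nf set_integrable_def hbI simp del: real_norm_def\<close>)
  have E: "indicator {0..} t *\<^sub>R E t = (\<integral>v. f (v, t) \<partial>lborel)" for t
  proof -
    have "(\<integral>v. f (v, t) \<partial>lborel) = (\<integral>v. (indicator {0..} t * exp (-2 * pi * A * t)) *
        (indicator {0..1} v *\<^sub>R exp (-2 * pi * B * t * v\<^sup>2)) \<partial>lborel)"
      by (rule Bochner_Integration.integral_cong)
         (auto simp: f_def mult_exp_exp indicator_def algebra_simps)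
    also have "\<dots> = (indicator {0..} t * exp (-2 * pi * A * t)) *
        (\<integral>v. indicator {0..1} v *\<^sub>R exp (-2 * pi * B * t * v\<^sup>2) \<partial>lborel)"
      by (rule integral_mult_right_zero)
    finally show ?thesis by (simp add: E_def set_lebesgue_integral_def)
  qed
  show "set_integrable lborel {0..} E"
    using lborel_pair.integrable_snd[of "\<lambda>v t. f (v, t)"] If unfolding set_integrable_def E by simp
  show "(LINT t:{0..}|lborel. E t) = (LINT v:{0..1}|lborel. 1 / (2 * pi * (A + B * v\<^sup>2)))"
  proof -
    have "(\<integral>t. (\<integral>v. f (v, t) \<partial>lborel) \<partial>lborel) = (\<integral>v. (\<integral>t. f (v, t) \<partial>lborel) \<partial>lborel)"
      by (rule lborel_pair.Fubini_integral) (use If in simp)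
    thus ?thesis unfolding set_lebesgue_integral_def E hbI .
  qed
qed

text \<open>A primitive in v is a multiple of arctan (sqrt (d / c) y v / x). The factor 2 stems from
  the substitution in \<open>iterated_integral_eq\<close>, while \<open>x\<close> and
  \<open>y\<close> are the weights N and M of the two theta series. The case \<open>y = 0\<close>,
  where both sides are 0, is separate because \<open>F\<close> divides by \<open>y\<close>.\<close>

lemma arctan_kernel:
  fixes c d x y :: real
  assumes "c > 0" "d > 0" "x \<noteq> 0"
  shows "2 * x * y * (LINT v:{0..1}|lborel. 1 / (2 * pi * (c * x\<^sup>2 + d * y\<^sup>2 * v\<^sup>2))) =
    1 / (pi * sqrt (c * d)) * arctan (sqrt (d / c) * y / x)"
proof -
  define F where "F v = 1 / (2 * pi * sqrt (c * d) * x * y) * arctan (sqrt (d / c) * y / x * v)" for v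
  have pos: "c * x\<^sup>2 + d * y\<^sup>2 * v\<^sup>2 > 0" for v
    using assms by (simp add: add_pos_nonneg)
  have cont: "continuous_on {0..1} (\<lambda>v. 1 / (2 * pi * (c * x\<^sup>2 + d * y\<^sup>2 * v\<^sup>2)))"
    using pos by (intro continuous_intros) (metis less_irrefl mult_eq_0_iff pi_neq_zero zero_neq_numeral)
  have int: "(LINT v:{0..1}|lborel. 1 / (2 * pi * (c * x\<^sup>2 + d * y\<^sup>2 * v\<^sup>2))) =
      integral {0..1} (\<lambda>v. 1 / (2 * pi * (c * x\<^sup>2 + d * y\<^sup>2 * v\<^sup>2)))"
    by (rule set_borel_integral_eq_integral(2)[OF borel_integrable_atLeastAtMost'[OF cont]])
  show ?thesis
  proof (cases "y = 0")
    case False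
    have "(F has_real_derivative 1 / (2 * pi * (c * x\<^sup>2 + d * y\<^sup>2 * v\<^sup>2))) (at v)" for v
    proof -
      have sq: "sqrt (c * d) = c * sqrt (d / c)" "(sqrt (d / c))\<^sup>2 = d / c"
        using assms by (auto simp: real_sqrt_mult real_sqrt_divide field_simps)
      have s0: "sqrt (d / c) \<noteq> 0" using assms by simp
      have "1 + (sqrt (d / c) * y / x * v)\<^sup>2 = (c * x\<^sup>2 + d * y\<^sup>2 * v\<^sup>2) / (c * x\<^sup>2)"
        using assms sq(2) by (simp add: power_mult_distrib power_divide field_simps)
      hence i: "inverse (1 + (sqrt (d / c) * y / x * v)\<^sup>2) = (c * x\<^sup>2) / (c * x\<^sup>2 + d * y\<^sup>2 * v\<^sup>2)"
        by simp
      have "(F has_real_derivative 1 / (2 * pi * sqrt (c * d) * x * y) *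
          (inverse (1 + (sqrt (d / c) * y / x * v)\<^sup>2) * (sqrt (d / c) * y / x))) (at v)"
        unfolding F_def[abs_def]
        by (intro DERIV_cmult DERIV_chain2[OF DERIV_arctan] DERIV_cmult_Id)
      also have "1 / (2 * pi * sqrt (c * d) * x * y) *
          (inverse (1 + (sqrt (d / c) * y / x * v)\<^sup>2) * (sqrt (d / c) * y / x)) =
          1 / (2 * pi * (c * x\<^sup>2 + d * y\<^sup>2 * v\<^sup>2))"
        unfolding i sq(1) using False assms s0 pos[of v] by (simp add: power2_eq_square field_simps)
      finally show ?thesis .
    qed
    hence "((\<lambda>v. 1 / (2 * pi * (c * x\<^sup>2 + d * y\<^sup>2 * v\<^sup>2))) has_integral F 1 - F 0) {0..1}"
      by (intro fundamental_theorem_of_calculus)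
         (auto simp: has_real_derivative_iff_has_vector_derivative [symmetric]
           intro: has_field_derivative_at_within)
    hence "(LINT v:{0..1}|lborel. 1 / (2 * pi * (c * x\<^sup>2 + d * y\<^sup>2 * v\<^sup>2))) = F 1 - F 0"
      unfolding int by (rule integral_unique)
    thus ?thesis using False assms by (simp add: F_def)
  qed auto
qed

text \<open>Substituting x = v^2 turns dx / sqrt x into 2 dv. The primitive
  \<open>2 * G (sqrt x)\<close> is continuous on the closed interval but in general not
  differentiable at 0, hence the interior form of the fundamental theorem.\<close>

lemma has_integral_sqrt_substitution:
  fixes g :: "real \<Rightarrow> complex"
  assumes "continuous_on {0..1} g"
  shows "((\<lambda>x. g (sqrt x) / of_real (sqrt x)) has_integral 2 * integral {0..1} g) {0..1}"
proof -
  define G where "G x = integral {0..x} g" for x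
  have G: "(G has_vector_derivative g x) (at x within {0..1})" if "x \<in> {0..1}" for x
    unfolding G_def by (rule integral_has_vector_derivative[OF assms that])
  have contG: "continuous_on {0..1} G"
    using G by (meson has_vector_derivative_continuous continuous_on_eq_continuous_within)
  have "((\<lambda>x. g (sqrt x) / of_real (sqrt x)) has_integral 2 * G (sqrt 1) - 2 * G (sqrt 0)) {0..1}"
  proof (rule fundamental_theorem_of_calculus_interior)
    show "continuous_on {0..1} (\<lambda>x. 2 * G (sqrt x))"
      by (intro continuous_intros continuous_on_compose2[OF contG]) auto
    fix x :: real assume x: "x \<in> {0<..<1}"
    have "(G has_vector_derivative g (sqrt x)) (at (sqrt x))"
      using G[of "sqrt x"] x at_within_Icc_at[of 0 "sqrt x" 1] by simp
    moreover have "(sqrt has_vector_derivative inverse (sqrt x) / 2) (at x)"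
      using DERIV_real_sqrt[of x] x by (simp add: has_real_derivative_iff_has_vector_derivative)
    ultimately have "(G \<circ> sqrt has_vector_derivative (inverse (sqrt x) / 2) *\<^sub>R g (sqrt x)) (at x)"
      by (intro vector_diff_chain_at)
    from has_vector_derivative_mult_right[OF this, of 2]
    show "((\<lambda>x. 2 * G (sqrt x)) has_vector_derivative g (sqrt x) / of_real (sqrt x)) (at x)"
      by (simp add: o_def scaleR_conv_of_real field_simps of_real_inverse)
  qed simp
  thus ?thesis by (simp add: G_def)
qed

text \<open>With w1 = \<tau> + i t and w2 = \<tau> + i t x the roots are i sqrt t and i sqrt (t x).
  The inner integral becomes sqrt t times an integral against dx / sqrt x, the substitution x = v^2
  contributes the 2, and the remaining sqrt t cancels the outer root.\<close>

lemma iterated_integral_eq: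
  assumes cont: "\<And>t. t \<ge> 0 \<Longrightarrow> continuous_on {0..1} (\<lambda>v. g (\<tau> + \<i> * of_real (t * v\<^sup>2)))"
  shows "iterated_integral f g \<tau> = integral {0..} (\<lambda>t.
    2 * f (\<tau> + \<i> * of_real t) * integral {0..1} (\<lambda>v. g (\<tau> + \<i> * of_real (t * v\<^sup>2))))"
proof -
  have csq: "csqrt (- of_real x) = \<i> * of_real (sqrt x)" if "x \<ge> 0" for x
    using that by (simp add: csqrt_of_real_nonpos flip: of_real_minus)
  have inner: "contour_integral (linepath \<tau> (\<tau> + \<i> * of_real t)) (\<lambda>w2. g w2 / csqrt (\<i> * (w2 - \<tau>))) =
      of_real (sqrt t) * (2 * integral {0..1} (\<lambda>v. g (\<tau> + \<i> * of_real (t * v\<^sup>2))))" if "t > 0" for t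
  proof -
    have "((\<lambda>x. g (\<tau> + \<i> * of_real (t * (sqrt x)\<^sup>2)) / of_real (sqrt x)) has_integral
        2 * integral {0..1} (\<lambda>v. g (\<tau> + \<i> * of_real (t * v\<^sup>2)))) {0..1}"
      using that by (intro has_integral_sqrt_substitution cont) auto
    from has_integral_mult_right[OF this, of "of_real (sqrt t)"]
    have "((\<lambda>x. g (linepath \<tau> (\<tau> + \<i> * of_real t) x) /
          csqrt (\<i> * (linepath \<tau> (\<tau> + \<i> * of_real t) x - \<tau>)) * (\<tau> + \<i> * of_real t - \<tau>)) has_integral
        of_real (sqrt t) * (2 * integral {0..1} (\<lambda>v. g (\<tau> + \<i> * of_real (t * v\<^sup>2))))) {0..1}"
    proof (rule has_integral_eq[rotated])
      fix x :: real assume x: "x \<in> {0..1}"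
      have l: "linepath \<tau> (\<tau> + \<i> * of_real t) x = \<tau> + \<i> * of_real (t * x)"
        by (simp add: linepath_def scaleR_conv_of_real algebra_simps)
      have c: "csqrt (\<i> * (\<tau> + \<i> * of_real (t * x) - \<tau>)) = \<i> * of_real (sqrt (t * x))"
        using csq[of "t * x"] that x by simp
      have "of_real t = of_real (sqrt t) * (of_real (sqrt t) :: complex)"
        using that by (simp flip: of_real_mult)
      thus "of_real (sqrt t) * (g (\<tau> + \<i> * of_real (t * (sqrt x)\<^sup>2)) / of_real (sqrt x)) =
        g (linepath \<tau> (\<tau> + \<i> * of_real t) x) /
          csqrt (\<i> * (linepath \<tau> (\<tau> + \<i> * of_real t) x - \<tau>)) * (\<tau> + \<i> * of_real t - \<tau>)"
        unfolding l c using x that by (auto simp: real_sqrt_mult field_simps)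
    qed
    thus ?thesis
      by (intro contour_integral_unique) (simp add: has_contour_integral_linepath)
  qed
  have "iterated_integral f g \<tau> = integral {0..} (\<lambda>t. f (\<tau> + \<i> * of_real t) / csqrt (- of_real t) *
      contour_integral (linepath \<tau> (\<tau> + \<i> * of_real t)) (\<lambda>w2. g w2 / csqrt (\<i> * (w2 - \<tau>))) * \<i>)"
    unfolding iterated_integral_def vertical_integral_def by simp
  also have "\<dots> = integral {0..} (\<lambda>t.
    2 * f (\<tau> + \<i> * of_real t) * integral {0..1} (\<lambda>v. g (\<tau> + \<i> * of_real (t * v\<^sup>2))))"
  \<comment> \<open>At t = 0 the integrand containing the roots is 0 by division by zero and may
    differ from the other one; a single point is negligible.\<close>
  proof (rule integral_spike[of "{0}"])
    fix t :: real assume "t \<in> {0..} - {0}"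
    hence t: "t > 0" by auto
    show "2 * f (\<tau> + \<i> * of_real t) * integral {0..1} (\<lambda>v. g (\<tau> + \<i> * of_real (t * v\<^sup>2))) =
      f (\<tau> + \<i> * of_real t) / csqrt (- of_real t) *
      contour_integral (linepath \<tau> (\<tau> + \<i> * of_real t)) (\<lambda>w2. g w2 / csqrt (\<i> * (w2 - \<tau>))) * \<i>"
      unfolding inner[OF t] using t csq[of t] by (simp add: field_simps)
  qed simp
  finally show ?thesis .
qed

text \<open>For integers |N| \<le> N^2, so the Gaussian is at most exp (-c |N|). One half of this
  exponent gives a geometric series; the other half absorbs the factor |N| through y \<le> exp
  y.\<close>

lemma summable_gaussian:
  fixes c :: real
  assumes "c > 0"
  shows "(\<lambda>N::int. \<bar>real_of_int N\<bar> * exp (- c * (real_of_int N)\<^sup>2)) summable_on UNIV"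
    and "(\<lambda>N::int. exp (- c * (real_of_int N)\<^sup>2)) summable_on UNIV"
proof -
  have *: "(\<lambda>N::int. exp (- c/2) ^ nat \<bar>N\<bar>) summable_on UNIV"
  proof -
    have s: "(\<lambda>n::nat. exp (- c/2) ^ n) summable_on UNIV"
      using assms by (intro summable_nonneg_imp_summable_on summable_geometric) auto
    have i1: "inj_on int UNIV" and i2: "inj_on (\<lambda>n. - int n) UNIV" by (auto simp: inj_on_def)
    have "(\<lambda>N::int. exp (- c/2) ^ nat \<bar>N\<bar>) summable_on (range int \<union> range (\<lambda>n. - int n))"
      by (rule summable_on_union) (use s in \<open>auto simp: summable_on_reindex[OF i1] summable_on_reindex[OF i2] o_def\<close>)
    also have "range int \<union> range (\<lambda>n. - int n) = UNIV"
      by (auto simp: image_iff) (metis int_cases2)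
    finally show ?thesis .
  qed
  have sq: "\<bar>real_of_int N\<bar> \<le> (real_of_int N)\<^sup>2" for N
  proof -
    have "\<bar>N\<bar> * 1 \<le> \<bar>N\<bar> * \<bar>N\<bar>" by (cases "N = 0", simp, intro mult_left_mono, auto)
    hence "of_int \<bar>N\<bar> \<le> (of_int (N\<^sup>2) :: real)" unfolding of_int_le_iff by (simp add: power2_eq_square)
    thus ?thesis by simp
  qed
  have b: "exp (- c * (real_of_int N)\<^sup>2) \<le> exp (- c/2) ^ nat \<bar>N\<bar> * exp (- c / 2 * \<bar>real_of_int N\<bar>)" for N
  proof -
    have "exp (- c * (real_of_int N)\<^sup>2) \<le> exp (- c * \<bar>real_of_int N\<bar>)"
      using sq[of N] assms by simp
    also have "\<dots> = exp (- c/2) ^ nat \<bar>N\<bar> * exp (- c / 2 * \<bar>real_of_int N\<bar>)"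
      by (simp add: exp_of_nat_mult [symmetric] mult_exp_exp field_simps)
    finally show ?thesis .
  qed
  show "(\<lambda>N::int. exp (- c * (real_of_int N)\<^sup>2)) summable_on UNIV"
  proof (rule summable_on_comparison_test[OF *])
    fix N :: int
    have "exp (- c / 2 * \<bar>real_of_int N\<bar>) \<le> 1" using assms by simp
    thus "exp (- c * (real_of_int N)\<^sup>2) \<le> exp (- c/2) ^ nat \<bar>N\<bar>"
      using b[of N] by (smt (verit) mult_left_le exp_ge_zero zero_le_power)
  qed auto
  show "(\<lambda>N::int. \<bar>real_of_int N\<bar> * exp (- c * (real_of_int N)\<^sup>2)) summable_on UNIV"
  proof (rule summable_on_comparison_test[OF summable_on_cmult_right[OF *, of "2 / c"]])
    fix N :: int
    have "c / 2 * \<bar>real_of_int N\<bar> \<le> exp (c / 2 * \<bar>real_of_int N\<bar>)"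
      using exp_ge_add_one_self[of "c / 2 * \<bar>real_of_int N\<bar>"] by linarith
    hence e: "\<bar>real_of_int N\<bar> * exp (- c / 2 * \<bar>real_of_int N\<bar>) \<le> 2 / c"
      using assms by (simp add: exp_minus field_simps)
    have "\<bar>real_of_int N\<bar> * exp (- c * (real_of_int N)\<^sup>2) \<le>
        \<bar>real_of_int N\<bar> * (exp (- c/2) ^ nat \<bar>N\<bar> * exp (- c / 2 * \<bar>real_of_int N\<bar>))"
      by (intro mult_left_mono b) auto
    also have "\<dots> = (\<bar>real_of_int N\<bar> * exp (- c / 2 * \<bar>real_of_int N\<bar>)) * exp (- c/2) ^ nat \<bar>N\<bar>"
      by simp
    also have "\<dots> \<le> 2 / c * exp (- c/2) ^ nat \<bar>N\<bar>"
      by (intro mult_right_mono e) auto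
    finally show "\<bar>real_of_int N\<bar> * exp (- c * (real_of_int N)\<^sup>2) \<le> 2 / c * exp (- c/2) ^ nat \<bar>N\<bar>" .
  qed auto
qed

section \<open>Powers of q and termwise evaluation of the iterated integral\<close>

lemma qpow_add: "qpow \<tau> (x + y) = qpow \<tau> x * qpow \<tau> y"
  by (simp add: qpow_def exp_add [symmetric] algebra_simps)

lemma norm_qpow: "norm (qpow \<tau> x) = exp (- (2 * pi * Im \<tau>) * x)"
  by (simp add: qpow_def algebra_simps)

lemma qpow_vertical:
  "qpow (\<tau> + \<i> * of_real t) x = qpow \<tau> x * of_real (exp (- 2 * pi * x * t))"
proof -
  have "2 * of_real pi * \<i> * of_real x * (\<tau> + \<i> * of_real t) =
     2 * of_real pi * \<i> * of_real x * \<tau> + of_real (- 2 * pi * x * t)"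
    by (simp add: algebra_simps)
  thus ?thesis unfolding qpow_def exp_of_real [symmetric] by (metis exp_add)
qed

text \<open>For a single pair, \<open>exp_kernel\<close> and then \<open>arctan_kernel\<close>
  evaluate the integral; the work lies in exchanging summation with the inner and then with the
  outer integration. The formula also covers N = 0: there the quotient in the arctangent is 0 by
  convention, and so is the weight \<open>of_int N\<close>.\<close>

lemma has_sum_iterated_integral:
  fixes \<alpha> \<beta> :: "int \<Rightarrow> complex" and c d :: real
  assumes \<tau>: "Im \<tau> > 0" and cd: "c > 0" "d > 0"
    and \<alpha>: "\<And>N. norm (\<alpha> N) \<le> 1" and \<beta>: "\<And>M. norm (\<beta> M) \<le> 1"
    and f: "\<And>w. Im w > 0 \<Longrightarrow> f w = (\<Sum>\<^sub>\<infinity>N\<in>S. \<alpha> N * of_int N * qpow w (c * (of_int N)\<^sup>2))"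
    and g: "\<And>w. Im w > 0 \<Longrightarrow> g w = (\<Sum>\<^sub>\<infinity>M\<in>T. \<beta> M * of_int M * qpow w (d * (of_int M)\<^sup>2))"
  shows "((\<lambda>(N, M). \<alpha> N * \<beta> M * of_real (1 / (pi * sqrt (c * d)) * arctan (sqrt (d / c) * of_int M / of_int N)) *
            qpow \<tau> (c * (of_int N)\<^sup>2 + d * (of_int M)\<^sup>2)) has_sum iterated_integral f g \<tau>) (S \<times> T)"
proof -
  define A where "A N = \<alpha> N * of_int N * qpow \<tau> (c * (of_int N)\<^sup>2)" for N
  define B where "B M = \<beta> M * of_int M * qpow \<tau> (d * (of_int M)\<^sup>2)" for M
  define e where "e M t = (LINT v:{0..1}|lborel. exp (- 2 * pi * (d * (of_int M)\<^sup>2) * t * v\<^sup>2))" for M :: int and t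
  have summ: "(\<lambda>N. norm (\<gamma> N * of_int N * qpow \<tau> (b * (of_int N)\<^sup>2))) summable_on U"
    if b: "b > 0" and \<gamma>: "\<And>N. norm (\<gamma> N) \<le> 1" for b :: real and \<gamma> :: "int \<Rightarrow> complex" and U
  proof (rule summable_on_comparison_test)
    show "(\<lambda>N. \<bar>real_of_int N\<bar> * exp (- (2 * pi * Im \<tau> * b) * (real_of_int N)\<^sup>2)) summable_on U"
      using b \<tau> by (intro summable_on_subset[OF summable_gaussian(1)]) auto
    show "norm (\<gamma> N * of_int N * qpow \<tau> (b * (of_int N)\<^sup>2)) \<le>
        \<bar>real_of_int N\<bar> * exp (- (2 * pi * Im \<tau> * b) * (real_of_int N)\<^sup>2)" for N
      using mult_right_mono[OF \<gamma>[of N], of "\<bar>real_of_int N\<bar> * exp (- (2 * pi * Im \<tau> * b) * (real_of_int N)\<^sup>2)"]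
      by (simp add: norm_mult norm_qpow mult_ac)
  qed auto
  have sA: "(\<lambda>N. norm (A N)) summable_on S" unfolding A_def by (rule summ[OF cd(1) \<alpha>])
  have sB: "(\<lambda>N. norm (B N)) summable_on T" unfolding B_def by (rule summ[OF cd(2) \<beta>])
  \<comment> \<open>Moving up the vertical path only shrinks the terms, so the absolute series at
    \<tau> dominate those at all heights.\<close>
  have decay: "exp (- 2 * pi * (b * x\<^sup>2) * t) \<le> 1" if "b > 0" "t \<ge> 0" for b x t :: real
    using that by simp
  have f_eq: "f (\<tau> + \<i> * of_real t) = (\<Sum>\<^sub>\<infinity>N\<in>S. A N * of_real (exp (- 2 * pi * (c * (of_int N)\<^sup>2) * t)))"
    if "t \<ge> 0" for t
    using that \<tau> by (subst f) (auto simp: qpow_vertical A_def mult_ac)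
  have g_eq: "g (\<tau> + \<i> * of_real t) = (\<Sum>\<^sub>\<infinity>N\<in>T. B N * of_real (exp (- 2 * pi * (d * (of_int N)\<^sup>2) * t)))"
    if "t \<ge> 0" for t
    using that \<tau> by (subst g) (auto simp: qpow_vertical B_def mult_ac)
  have sAt: "(\<lambda>N. norm (A N * of_real (exp (- 2 * pi * (c * (of_int N)\<^sup>2) * t)))) summable_on S"
    if "t \<ge> 0" for t
    by (rule summable_on_comparison_test[OF sA])
       (use decay[OF cd(1) that] in \<open>auto simp: norm_mult intro!: mult_left_le\<close>)
  have sBt: "(\<lambda>N. norm (B N * of_real (exp (- 2 * pi * (d * (of_int N)\<^sup>2) * t)))) summable_on T"
    if "t \<ge> 0" for t
    by (rule summable_on_comparison_test[OF sB])
       (use decay[OF cd(2) that] in \<open>auto simp: norm_mult intro!: mult_left_le\<close>)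
  have ie: "set_integrable lborel {0..1} (\<lambda>v. exp (- 2 * pi * (d * (of_int M)\<^sup>2) * t * v\<^sup>2))" for M t
    by (intro borel_integrable_atLeastAtMost' continuous_intros)
  have e0: "0 \<le> e M t" for M t
    unfolding e_def set_lebesgue_integral_def by (intro integral_nonneg_AE) auto
  have e1: "e M t \<le> 1" if "t \<ge> 0" for M t
  proof -
    have "e M t \<le> (LINT v:{0..1::real}|lborel. 1)"
      unfolding e_def
    proof (intro set_integral_mono ie)
      fix v :: real
      show "exp (- 2 * pi * (d * (of_int M)\<^sup>2) * t * v\<^sup>2) \<le> 1"
        using decay[OF cd(2), of "t * v\<^sup>2" "of_int M"] that by (simp add: mult.assoc)
    qed (intro borel_integrable_atLeastAtMost' continuous_intros)
    thus ?thesis by (simp add: set_lebesgue_integral_def)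
  qed
  \<comment> \<open>Uniform convergence by the Weierstrass test, with majorant
    \<open>norm (B N)\<close>, gives the continuity that \<open>iterated_integral_eq\<close>
    requires.\<close>
  have cont: "continuous_on {0..1} (\<lambda>v. g (\<tau> + \<i> * of_real (t * v\<^sup>2)))" if t: "t \<ge> 0" for t
  proof -
    have "uniform_limit {0..1}
       (\<lambda>X v. \<Sum>N\<in>X. B N * of_real (exp (- 2 * pi * (d * (of_int N)\<^sup>2) * (t * v\<^sup>2))))
       (\<lambda>v. \<Sum>\<^sub>\<infinity>N\<in>T. B N * of_real (exp (- 2 * pi * (d * (of_int N)\<^sup>2) * (t * v\<^sup>2))))
       (finite_subsets_at_top T)"
      by (rule Weierstrass_m_test_general[OF _ sB])
         (use cd(2) t in \<open>auto simp: norm_mult intro!: mult_left_le\<close>)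
    hence "continuous_on {0..1} (\<lambda>v. \<Sum>\<^sub>\<infinity>N\<in>T. B N * of_real (exp (- 2 * pi * (d * (of_int N)\<^sup>2) * (t * v\<^sup>2))))"
      by (rule uniform_limit_theorem[rotated]) (auto intro!: always_eventually continuous_intros)
    thus ?thesis using t by (subst g_eq) auto
  qed
  \<comment> \<open>First exchange: summation over M against integration over v.\<close>
  have inner: "((\<lambda>M. B M * of_real (e M t)) has_sum integral {0..1} (\<lambda>v. g (\<tau> + \<i> * of_real (t * v\<^sup>2)))) T"
    if t: "t \<ge> 0" for t
  proof -
    have L: "(LINT v:{0..1}|lborel. B M * of_real (exp (- 2 * pi * (d * (of_int M)\<^sup>2) * (t * v\<^sup>2)))) =
        B M * of_real (e M t)" for M
      unfolding e_def by (simp add: set_integral_complex_of_real mult.assoc)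
    have Ln: "(LINT v:{0..1}|lborel. norm (B M * of_real (exp (- 2 * pi * (d * (of_int M)\<^sup>2) * (t * v\<^sup>2))))) =
        norm (B M) * e M t" for M
      unfolding e_def by (simp add: norm_mult mult.assoc)
    have "((\<lambda>M. LINT v:{0..1}|lborel. B M * of_real (exp (- 2 * pi * (d * (of_int M)\<^sup>2) * (t * v\<^sup>2)))) has_sum
        integral {0..1} (\<lambda>v. \<Sum>\<^sub>\<infinity>M\<in>T. B M * of_real (exp (- 2 * pi * (d * (of_int M)\<^sup>2) * (t * v\<^sup>2))))) T"
    proof (rule has_sum_integral_countable)
      show "set_integrable lborel {0..1} (\<lambda>v. B M * of_real (exp (- 2 * pi * (d * (of_int M)\<^sup>2) * (t * v\<^sup>2))))" for M
        by (intro borel_integrable_atLeastAtMost' continuous_intros)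
      show "(\<lambda>M. LINT v:{0..1}|lborel. norm (B M * of_real (exp (- 2 * pi * (d * (of_int M)\<^sup>2) * (t * v\<^sup>2))))) summable_on T"
        unfolding Ln by (rule summable_on_comparison_test[OF sB]) (use e0 e1[OF t] in \<open>auto intro!: mult_left_le\<close>)
      show "(\<lambda>M. norm (B M * of_real (exp (- 2 * pi * (d * (of_int M)\<^sup>2) * (t * v\<^sup>2))))) summable_on T" for v
        by (rule sBt) (use t in auto)
    qed
    also have "integral {0..1} (\<lambda>v. \<Sum>\<^sub>\<infinity>M\<in>T. B M * of_real (exp (- 2 * pi * (d * (of_int M)\<^sup>2) * (t * v\<^sup>2)))) =
        integral {0..1} (\<lambda>v. g (\<tau> + \<i> * of_real (t * v\<^sup>2)))"
      by (intro integral_cong) (use t in \<open>auto simp del: of_real_mult simp: g_eq\<close>)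
    finally show ?thesis unfolding L .
  qed
  \<comment> \<open>\<open>K\<close> is the decay in t of the pair (N, M) after integration over v;
    for N \<noteq> 0, \<open>J\<close> is its integral over the half-line.\<close>
  define K where "K N M t = exp (- 2 * pi * (c * (of_int N)\<^sup>2) * t) * e M t" for N M :: int and t
  define J where "J N M = (LINT v:{0..1}|lborel. 1 / (2 * pi * (c * (of_int N)\<^sup>2 + d * (of_int M)\<^sup>2 * v\<^sup>2)))" for N M :: int
  have K: "set_integrable lborel {0..} (K N M)" "(LINT t:{0..}|lborel. K N M t) = J N M" if "N \<noteq> 0" for N M
    unfolding K_def e_def J_def using that cd by (intro exp_kernel; simp)+
  have K0: "K N M t \<ge> 0" for N M t using e0 by (simp add: K_def)
  define h where "h = (\<lambda>(N, M) t. 2 * (A N * B M) * of_real (K N M t))"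
  \<comment> \<open>For N = 0 the kernel \<open>K\<close> is not integrable over the half-line; that
    row disappears because \<open>A 0 = 0\<close>.\<close>
  have h0: "h (N, M) = (\<lambda>_. 0)" if "N = 0" for N M using that by (auto simp: h_def A_def fun_eq_iff)
  have hi: "set_integrable lborel {0..} (h p)" for p
  proof (cases "fst p = 0")
    case False
    hence "set_integrable lborel {0..} (\<lambda>t. complex_of_real (K (fst p) (snd p) t))"
      using K(1)[of "fst p" "snd p"] by (simp add: set_integrable_def complex_of_real_integrable_eq scaleR_conv_of_real flip: of_real_mult)
    thus ?thesis by (simp add: h_def case_prod_unfold)
  qed (cases p, simp add: h0 set_integrable_def)
  have hL: "(LINT t:{0..}|lborel. h (N, M) t) = 2 * (A N * B M) * of_real (J N M)" for N M
  proof (cases "N = 0")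
    case False
    thus ?thesis using K(2)[of N M] by (simp add: h_def set_integral_complex_of_real)
  qed (simp add: h0, simp add: A_def)
  have hN: "(LINT t:{0..}|lborel. norm (h (N, M) t)) = 2 * norm (A N * B M) * J N M" for N M
  proof (cases "N = 0")
    case False
    have "norm (h (N, M) t) = 2 * norm (A N * B M) * K N M t" for t
      using K0[of N M t] by (simp add: h_def norm_mult)
    thus ?thesis using K(2)[OF False, of M] by simp
  qed (simp add: h0, simp add: A_def)
  have J0: "0 \<le> J N M" for N M
    unfolding J_def set_lebesgue_integral_def using cd by (intro integral_nonneg_AE) auto
  \<comment> \<open>From N^2 \<ge> 1 the integrals \<open>J\<close> get a bound independent of N and
    M, so the norms of \<open>A N * B M\<close> majorise the integrated norms up to a
    constant.\<close>
  have J1: "J N M \<le> 1 / (2 * pi * c)" if "N \<noteq> 0" for N M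
  proof -
    have "1 \<le> N\<^sup>2" using that by (simp add: int_one_le_iff_zero_less)
    hence "of_int 1 \<le> real_of_int (N\<^sup>2)" unfolding of_int_le_iff .
    hence n: "1 \<le> (real_of_int N)\<^sup>2" by simp
    have den: "c \<le> c * (of_int N)\<^sup>2 + d * (of_int M)\<^sup>2 * v\<^sup>2" for v
      using mult_left_mono[OF n, of c] cd by (simp add: add_increasing2)
    hence pos: "0 < c * (of_int N)\<^sup>2 + d * (of_int M)\<^sup>2 * v\<^sup>2" for v
      using cd(1) by (rule less_le_trans[rotated])
    have "J N M \<le> (LINT v:{0..1::real}|lborel. 1 / (2 * pi * c))"
      unfolding J_def
    proof (intro set_integral_mono borel_integrable_atLeastAtMost' continuous_intros ballI)
      fix v :: real
      show "2 * pi * (c * (of_int N)\<^sup>2 + d * (of_int M)\<^sup>2 * v\<^sup>2) \<noteq> 0"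
        using pos[of v] by simp
      show "1 / (2 * pi * (c * (of_int N)\<^sup>2 + d * (of_int M)\<^sup>2 * v\<^sup>2)) \<le> 1 / (2 * pi * c)"
        using den[of v] pos[of v] cd by (intro divide_left_mono mult_left_mono mult_pos_pos) auto
    qed
    thus ?thesis by (simp add: set_lebesgue_integral_def)
  qed
  note P = has_sum_prod_abs[OF sA sB]
  \<comment> \<open>Second exchange: summation over pairs against integration over t. The integrated
    norms are controlled by \<open>J1\<close>, the pointwise ones by
    \<open>K N M t \<le> 1\<close>.\<close>
  have main: "((\<lambda>p. LINT t:{0..}|lborel. h p t) has_sum integral {0..} (\<lambda>t. \<Sum>\<^sub>\<infinity>p\<in>S \<times> T. h p t)) (S \<times> T)"
  proof (rule has_sum_integral_countable[OF hi])
    have "(\<lambda>(N, M). 1 / (pi * c) * norm (A N * B M)) summable_on S \<times> T"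
      using summable_on_cmult_right[OF P(1), of "1 / (pi * c)"] by (simp add: case_prod_unfold)
    thus "(\<lambda>p. LINT t:{0..}|lborel. norm (h p t)) summable_on S \<times> T"
    proof (rule summable_on_comparison_test)
      fix p :: "int \<times> int"
      obtain N M where p: "p = (N, M)" by (cases p)
      show "(LINT t:{0..}|lborel. norm (h p t)) \<le> (case p of (N, M) \<Rightarrow> 1 / (pi * c) * norm (A N * B M))"
      proof (cases "N = 0")
        case False
        show ?thesis using mult_left_mono[OF J1[OF False, of M], of "2 * norm (A N * B M)"]
          by (simp add: p hN)
      qed (use cd in \<open>simp add: p h0\<close>)
      show "0 \<le> (LINT t:{0..}|lborel. norm (h p t))"
        using J0 by (simp add: p hN)
    qed
    fix t :: real assume t: "t \<in> {0..}"
    show "(\<lambda>p. norm (h p t)) summable_on S \<times> T"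
    proof (rule summable_on_comparison_test[OF summable_on_cmult_right[OF P(1), of 2]])
      fix p :: "int \<times> int"
      obtain N M where p: "p = (N, M)" by (cases p)
      have "K N M t \<le> 1 * 1" unfolding K_def
        by (intro mult_mono decay e1 e0) (use cd t in auto)
      thus "norm (h p t) \<le> 2 * (case p of (x, y) \<Rightarrow> norm (A x * B y))"
        using K0[of N M t] by (auto simp: p h_def norm_mult intro!: mult_left_mono mult_left_le)
    qed auto
  qed
  \<comment> \<open>At fixed t the double sum factors into the series of \<open>f\<close> and the
    inner sum found above.\<close>
  have ptw: "(\<Sum>\<^sub>\<infinity>p\<in>S \<times> T. h p t) = 2 * f (\<tau> + \<i> * of_real t) *
      integral {0..1} (\<lambda>v. g (\<tau> + \<i> * of_real (t * v\<^sup>2)))" if t: "t \<in> {0..}" for t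
  proof -
    have sBe: "(\<lambda>M. norm (B M * of_real (e M t))) summable_on T"
      by (rule summable_on_comparison_test[OF sB])
         (use e0 e1 t in \<open>auto simp: norm_mult intro!: mult_left_le\<close>)
    have "((\<lambda>(N, M). A N * of_real (exp (- 2 * pi * (c * (of_int N)\<^sup>2) * t)) * (B M * of_real (e M t))) has_sum
       f (\<tau> + \<i> * of_real t) * integral {0..1} (\<lambda>v. g (\<tau> + \<i> * of_real (t * v\<^sup>2)))) (S \<times> T)"
      using has_sum_prod_abs(2)[OF sAt sBe, of t] f_eq[of t] infsumI[OF inner[of t]] t by simp
    from has_sum_cmult_right[OF this, of 2] show ?thesis
      by (intro infsumI) (simp add: h_def K_def case_prod_unfold mult_ac)
  qed
  have "integral {0..} (\<lambda>t. \<Sum>\<^sub>\<infinity>p\<in>S \<times> T. h p t) = iterated_integral f g \<tau>"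
  proof -
    have "iterated_integral f g \<tau> = integral {0..} (\<lambda>t. 2 * f (\<tau> + \<i> * of_real t) *
        integral {0..1} (\<lambda>v. g (\<tau> + \<i> * of_real (t * v\<^sup>2))))"
      by (rule iterated_integral_eq) (rule cont)
    also have "\<dots> = integral {0..} (\<lambda>t. \<Sum>\<^sub>\<infinity>p\<in>S \<times> T. h p t)"
      by (rule integral_cong) (rule ptw[symmetric])
    finally show ?thesis by (rule sym)
  qed
  with main have "((\<lambda>p. LINT t:{0..}|lborel. h p t) has_sum iterated_integral f g \<tau>) (S \<times> T)" by simp
  also have "(\<lambda>p. LINT t:{0..}|lborel. h p t) =
     (\<lambda>(N, M). \<alpha> N * \<beta> M * of_real (1 / (pi * sqrt (c * d)) * arctan (sqrt (d / c) * of_int M / of_int N)) *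
            qpow \<tau> (c * (of_int N)\<^sup>2 + d * (of_int M)\<^sup>2))"
  proof (rule ext, clarify)
    fix N M :: int
    show "(LINT t:{0..}|lborel. h (N, M) t) = \<alpha> N * \<beta> M * of_real (1 / (pi * sqrt (c * d)) *
        arctan (sqrt (d / c) * of_int M / of_int N)) * qpow \<tau> (c * (of_int N)\<^sup>2 + d * (of_int M)\<^sup>2)"
    proof (cases "N = 0")
      case False
      have "2 * of_int N * of_int M * J N M = 1 / (pi * sqrt (c * d)) * arctan (sqrt (d / c) * of_int M / of_int N)"
        unfolding J_def by (rule arctan_kernel) (use cd False in auto)
      moreover have "(LINT t:{0..}|lborel. h (N, M) t) = \<alpha> N * \<beta> M *
          of_real (2 * of_int N * of_int M * J N M) * qpow \<tau> (c * (of_int N)\<^sup>2 + d * (of_int M)\<^sup>2)"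
        unfolding hL A_def B_def qpow_add by (simp add: mult_ac)
      ultimately show ?thesis by (simp only:)
    qed (simp add: h0)
  qed
  finally show ?thesis .
qed

subsection \<open>Jacobi's identity for the cube of the eta function\<close>

text \<open>The q-Pochhammer symbol (q; q)_n.\<close>

definition qfact :: "complex \<Rightarrow> nat \<Rightarrow> complex" where
  "qfact q n = (\<Prod>i<n. 1 - q ^ Suc i)"

text \<open>The Gaussian binomial coefficient. The value 0 for l > m lets the Pascal recursion hold
  at l = m as well.\<close>

definition qbinomial :: "complex \<Rightarrow> nat \<Rightarrow> nat \<Rightarrow> complex" where
  "qbinomial q m l = (if l \<le> m then qfact q m / (qfact q l * qfact q (m - l)) else 0)"

lemma qfact_0 [simp]: "qfact q 0 = 1"
  and qfact_Suc: "qfact q (Suc n) = qfact q n * (1 - q ^ Suc n)"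
  by (simp_all add: qfact_def)

lemma one_minus_power_neq_0:
  assumes "norm (q :: complex) < 1"
  shows "1 - q ^ Suc n \<noteq> 0"
proof
  assume "1 - q ^ Suc n = 0"
  hence "norm (q ^ Suc n) = 1" by simp
  thus False using power_Suc_less_one[of "norm q" n] assms
    by (cases "q = 0") (auto simp: norm_power norm_mult)
qed

lemma qfact_neq_0: "norm q < 1 \<Longrightarrow> qfact q n \<noteq> 0"
  using one_minus_power_neq_0[of q] by (auto simp: qfact_def)

text \<open>Over a common denominator this is 1 - q^(m+1) = (1 - q^(m-l)) + q^(m-l) (1 - q^(l+1));
  the denominators are nonzero because \<open>norm q < 1\<close>.\<close>

lemma qbinomial_pascal:
  assumes q: "norm q < 1" and l: "l \<le> m"
  shows "qbinomial q (Suc m) (Suc l) = qbinomial q m (Suc l) + q ^ (m - l) * qbinomial q m l"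
proof (cases "l = m")
  case True
  thus ?thesis using qfact_neq_0[OF q] by (simp add: qbinomial_def)
next
  case False
  with l obtain d where m: "m = Suc (l + d)" by (metis le_neq_implies_less less_imp_Suc_add)
  show ?thesis
    using qfact_neq_0[OF q] one_minus_power_neq_0[OF q, of l] one_minus_power_neq_0[OF q, of d]
    unfolding m qbinomial_def
    by (simp add: qfact_Suc Suc_diff_le divide_simps del: power_Suc) (simp add: algebra_simps power_add)
qed

lemma choose_2_Suc: "Suc l choose 2 = l + (l choose 2)"
  by (simp add: numeral_2_eq_2)

text \<open>Multiplication by the new factor 1 + x q^m is the Pascal recursion on coefficients: the
  power q^l supplied by \<open>choose_2_Suc\<close> completes q^(m-l) to q^m.\<close>

lemma q_binomial_theorem:
  assumes q: "norm q < 1"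
  shows "(\<Prod>i<m. 1 + x * q ^ i) = (\<Sum>l\<le>m. qbinomial q m l * q ^ (l choose 2) * x ^ l)"
proof (induction m)
  case 0
  show ?case by (simp add: qbinomial_def numeral_2_eq_2)
next
  case (Suc m)
  define T where "T m l = qbinomial q m l * q ^ (l choose 2) * x ^ l" for m l
  have T0: "T m 0 = 1" for m using qfact_neq_0[OF q] by (simp add: T_def qbinomial_def numeral_2_eq_2)
  have step: "T (Suc m) (Suc l) = T m (Suc l) + T m l * (x * q ^ m)" if "l \<le> m" for l
  proof -
    have "q ^ (m - l) * q ^ l = q ^ m" using that by (simp flip: power_add)
    thus ?thesis
      unfolding T_def qbinomial_pascal[OF q that] choose_2_Suc
      by (simp add: power_add algebra_simps)
  qed
  have "(\<Sum>l\<le>Suc m. T (Suc m) l) = T m 0 + (\<Sum>l\<le>m. T m (Suc l)) + (\<Sum>l\<le>m. T m l) * (x * q ^ m)"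
    by (subst sum.atMost_Suc_shift) (simp add: T0 step sum.distrib sum_distrib_right)
  also have "T m 0 + (\<Sum>l\<le>m. T m (Suc l)) = (\<Sum>l\<le>Suc m. T m l)"
    by (subst sum.atMost_Suc_shift) simp
  also have "\<dots> = (\<Sum>l\<le>m. T m l)"
    by (simp add: T_def qbinomial_def)
  finally have "(\<Sum>l\<le>Suc m. T (Suc m) l) = (\<Sum>l\<le>m. T m l) * (1 + x * q ^ m)"
    by (simp only: distrib_left mult_1_right)
  also have "(\<Sum>l\<le>m. T m l) = (\<Prod>i<m. 1 + x * q ^ i)"
    unfolding Suc.IH T_def ..
  finally show ?case unfolding T_def prod.lessThan_Suc by (rule sym)
qed

text \<open>Together with \<open>choose_2_shift_down\<close> this makes the exponents of the terms n
  + 1 + j and n - j agree: at x = -q^(-n), after multiplication by q^(n + 1 choose 2), both become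
  (j + 1 choose 2).\<close>

lemma choose_2_shift_up: "(n + 1 + j choose 2) + (n + 1 choose 2) = n * (n + 1 + j) + (j + 1 choose 2)"
proof (induction j)
  case 0
  show ?case by (induction n) (auto simp: choose_2_Suc numeral_2_eq_2)
qed (simp add: choose_2_Suc)

lemma choose_2_shift_down:
  "j \<le> n \<Longrightarrow> (n - j choose 2) + (n + 1 choose 2) = n * (n - j) + (j + 1 choose 2)"
proof -
  have "(i choose 2) + (i + j + 1 choose 2) = (i + j) * i + (j + 1 choose 2)" for i
    by (induction i) (auto simp: choose_2_Suc)
  from this[of "n - j"] show "j \<le> n \<Longrightarrow> ?thesis" by simp
qed

text \<open>Each factor is 1 - q^(-i) = -q^(-i) (1 - q^i), and the exponents i = 1, ..., n add up to
  (n + 1 choose 2).\<close>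

lemma prod_one_minus_inverse_power:
  assumes "q \<noteq> 0"
  shows "(\<Prod>i<n. 1 - inverse q ^ Suc i) * q ^ (n + 1 choose 2) = (-1) ^ n * qfact q n"
proof (induction n)
  case 0
  show ?case by (simp add: numeral_2_eq_2)
next
  case (Suc n)
  have e: "q ^ (Suc n + 1 choose 2) = q ^ Suc n * q ^ (n + 1 choose 2)"
    unfolding power_add [symmetric] by (simp add: choose_2_Suc)
  have "(\<Prod>i<Suc n. 1 - inverse q ^ Suc i) * q ^ (Suc n + 1 choose 2) =
      ((\<Prod>i<n. 1 - inverse q ^ Suc i) * q ^ (n + 1 choose 2)) * ((1 - inverse q ^ Suc n) * q ^ Suc n)"
    unfolding e prod.lessThan_Suc by (simp only: mult_ac)
  also have "(1 - inverse q ^ Suc n) * q ^ Suc n = - (1 - q ^ Suc n)"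
    using assms by (simp add: left_diff_distrib power_inverse del: power_Suc)
  finally show ?case unfolding Suc.IH qfact_Suc by (simp add: algebra_simps)
qed

lemma sum_fold_symmetric:
  fixes f :: "nat \<Rightarrow> 'a::comm_monoid_add"
  shows "(\<Sum>l\<le>2 * n + 1. f l) = (\<Sum>j\<le>n. f (n + 1 + j) + f (n - j))"
proof -
  have split: "{..2 * n + 1} = {..n} \<union> (\<lambda>j. n + 1 + j) ` {..n}"
  proof (intro equalityI subsetI)
    fix l assume "l \<in> {..2 * n + 1}"
    hence "l \<le> n \<or> (l - (n + 1) \<le> n \<and> l = n + 1 + (l - (n + 1)))" by auto
    thus "l \<in> {..n} \<union> (\<lambda>j. n + 1 + j) ` {..n}" by blast
  qed auto
  have "(\<Sum>l\<le>2 * n + 1. f l) = (\<Sum>l\<le>n. f l) + (\<Sum>l\<in>(\<lambda>j. n + 1 + j) ` {..n}. f l)"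
    unfolding split by (rule sum.union_disjoint) auto
  also have "(\<Sum>l\<in>(\<lambda>j. n + 1 + j) ` {..n}. f l) = (\<Sum>j\<le>n. f (n + 1 + j))"
    by (subst sum.reindex) (auto simp: inj_on_def)
  also have "(\<Sum>l\<le>n. f l) = (\<Sum>j\<le>n. f (n - j))"
    by (rule sum.reindex_bij_witness[of _ "\<lambda>j. n - j" "\<lambda>j. n - j"]) auto
  finally show ?thesis by (simp add: sum.distrib add.commute)
qed

text \<open>The derivative of the \<open>q\<close>-binomial theorem for \<open>m = 2 n + 1\<close> at the root
  \<open>x = - q\<^bsup>-n\<^esup>\<close>, with the terms of index \<open>n + 1 + j\<close> and \<open>n - j\<close> paired.\<close>

lemma jacobi_finite:
  assumes q: "norm q < 1" "q \<noteq> 0"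
  shows "qfact q n ^ 2 =
    (\<Sum>j\<le>n. (-1) ^ j * (2 * of_nat j + 1) * qbinomial q (2 * n + 1) (n - j) * q ^ (j + 1 choose 2))"
proof -
  define x0 where "x0 = - (inverse q ^ n)"
  define R where "R x = (\<Prod>i\<in>{..<2 * n + 1} - {n}. 1 + x * q ^ i)" for x
  define T where "T l = qbinomial q (2 * n + 1) l * q ^ (l choose 2) * x0 ^ l" for l
  have x0q: "x0 * q ^ n = -1" "x0 \<noteq> 0" using q by (auto simp: x0_def power_inverse)
  have R: "(\<Prod>i<2 * n + 1. 1 + x * q ^ i) = (1 + x * q ^ n) * R x" for x
    unfolding R_def by (rule prod.remove) auto
  have "R holomorphic_on UNIV" unfolding R_def[abs_def] by (intro holomorphic_intros)
  then obtain R' where R': "(R has_field_derivative R') (at x0)"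
    by (meson holomorphic_derivI open_UNIV UNIV_I)
  \<comment> \<open>The factor 1 + x q^n vanishes at \<open>x0\<close>, so the term containing the
    derivative of \<open>R\<close> drops out.\<close>
  have "((\<lambda>x. (1 + x * q ^ n) * R x) has_field_derivative q ^ n * R x0) (at x0)"
    using x0q by (auto intro!: derivative_eq_intros R')
  moreover have "((\<lambda>x. (1 + x * q ^ n) * R x) has_field_derivative
     (\<Sum>l\<le>2 * n + 1. qbinomial q (2 * n + 1) l * q ^ (l choose 2) * (of_nat l * x0 ^ (l - 1)))) (at x0)"
    unfolding R[symmetric] q_binomial_theorem[OF q(1)]
    by (intro DERIV_sum DERIV_cmult) (auto intro!: derivative_eq_intros)
  ultimately have "q ^ n * R x0 = (\<Sum>l\<le>2 * n + 1. qbinomial q (2 * n + 1) l * q ^ (l choose 2) * (of_nat l * x0 ^ (l - 1)))"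
    by (rule DERIV_unique)
  \<comment> \<open>Multiplying by \<open>x0\<close> restores the power x0^l in each term, and on
    the left x0 q^n = -1.\<close>
  hence "x0 * (q ^ n * R x0) = (\<Sum>l\<le>2 * n + 1. x0 * (qbinomial q (2 * n + 1) l * q ^ (l choose 2) * (of_nat l * x0 ^ (l - 1))))"
    by (simp only: sum_distrib_left)
  also have "\<dots> = (\<Sum>l\<le>2 * n + 1. of_nat l * T l)"
  proof (rule sum.cong)
    fix l show "x0 * (qbinomial q (2 * n + 1) l * q ^ (l choose 2) * (of_nat l * x0 ^ (l - 1))) = of_nat l * T l"
      by (cases l) (auto simp: T_def)
  qed simp
  also have "\<dots> = (\<Sum>j\<le>n. of_nat (n + 1 + j) * T (n + 1 + j) + of_nat (n - j) * T (n - j))"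
    by (rule sum_fold_symmetric)
  finally have 1: "- R x0 = (\<Sum>j\<le>n. of_nat (n + 1 + j) * T (n + 1 + j) + of_nat (n - j) * T (n - j))"
    using x0q(1) by (simp flip: mult.assoc)
  have pw: "q ^ a * x0 ^ l * q ^ b = (-1) ^ l * q ^ c" if "a + b = n * l + c" for a b c l
  proof -
    have "q ^ a * x0 ^ l * q ^ b = x0 ^ l * q ^ (n * l + c)" unfolding that[symmetric] by (simp add: power_add)
    also have "\<dots> = (x0 * q ^ n) ^ l * q ^ c" by (simp add: power_add power_mult power_mult_distrib)
    finally show ?thesis unfolding x0q .
  qed
  have Tu: "T (n + 1 + j) * q ^ (n + 1 choose 2) =
      (-1) ^ (n + 1 + j) * qbinomial q (2 * n + 1) (n - j) * q ^ (j + 1 choose 2)" if "j \<le> n" for j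
  proof -
    have "qbinomial q (2 * n + 1) (n + 1 + j) = qbinomial q (2 * n + 1) (n - j)"
    proof -
      have "2 * n + 1 - (n + 1 + j) = n - j" "2 * n + 1 - (n - j) = n + 1 + j" using that by auto
      thus ?thesis using that by (simp add: qbinomial_def mult.commute)
    qed
    hence "T (n + 1 + j) * q ^ (n + 1 choose 2) = qbinomial q (2 * n + 1) (n - j) *
        (q ^ (n + 1 + j choose 2) * x0 ^ (n + 1 + j) * q ^ (n + 1 choose 2))"
      unfolding T_def by (simp only: mult_ac)
    thus ?thesis unfolding pw[OF choose_2_shift_up[of n j]] by (simp only: mult_ac)
  qed
  \<comment> \<open>The indices n + 1 + j and n - j have odd sum 2 n + 1, hence opposite signs;
    their weights are therefore subtracted and leave the Jacobi coefficient 2 j + 1.\<close>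
  have Td: "T (n - j) * q ^ (n + 1 choose 2) =
      - ((-1) ^ (n + 1 + j) * qbinomial q (2 * n + 1) (n - j) * q ^ (j + 1 choose 2))" if "j \<le> n" for j
  proof -
    have "(-1::complex) ^ (n - j) = - ((-1) ^ (n + 1 + j))"
      using that by (auto simp: minus_one_power_iff)
    thus ?thesis using pw[OF choose_2_shift_down[OF that]] unfolding T_def by (simp add: mult_ac)
  qed
  have "- R x0 * q ^ (n + 1 choose 2) = (\<Sum>j\<le>n. of_nat (n + 1 + j) * (T (n + 1 + j) * q ^ (n + 1 choose 2)) +
      of_nat (n - j) * (T (n - j) * q ^ (n + 1 choose 2)))"
    unfolding 1 sum_distrib_right by (simp add: algebra_simps)
  also have "\<dots> = (\<Sum>j\<le>n. (-1) ^ (n + 1) * ((-1) ^ j * (2 * of_nat j + 1) * qbinomial q (2 * n + 1) (n - j) * q ^ (j + 1 choose 2)))"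
  proof (rule sum.cong)
    fix j assume "j \<in> {..n}"
    hence j: "j \<le> n" by simp
    have "(of_nat (n + 1 + j) - of_nat (n - j) :: complex) = 2 * of_nat j + 1"
      using j by (simp add: of_nat_diff)
    moreover have "of_nat (n + 1 + j) * (T (n + 1 + j) * q ^ (n + 1 choose 2)) +
      of_nat (n - j) * (T (n - j) * q ^ (n + 1 choose 2)) =
      (of_nat (n + 1 + j) - of_nat (n - j)) *
      ((-1) ^ (n + 1 + j) * qbinomial q (2 * n + 1) (n - j) * q ^ (j + 1 choose 2))"
      unfolding Tu[OF j] Td[OF j] by (simp only: left_diff_distrib mult_minus_right add_uminus_conv_diff)
    ultimately show "of_nat (n + 1 + j) * (T (n + 1 + j) * q ^ (n + 1 choose 2)) +
      of_nat (n - j) * (T (n - j) * q ^ (n + 1 choose 2)) =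
      (-1) ^ (n + 1) * ((-1) ^ j * (2 * of_nat j + 1) * qbinomial q (2 * n + 1) (n - j) * q ^ (j + 1 choose 2))"
      by (simp only: power_add mult_ac)
  qed simp
  finally have 2: "- R x0 * q ^ (n + 1 choose 2) = (-1) ^ (n + 1) *
    (\<Sum>j\<le>n. (-1) ^ j * (2 * of_nat j + 1) * qbinomial q (2 * n + 1) (n - j) * q ^ (j + 1 choose 2))"
    by (simp only: sum_distrib_left)
  \<comment> \<open>The factors with index above n give \<open>qfact q n\<close>; those below n, in
    reversed order, give the product in \<open>prod_one_minus_inverse_power\<close>.\<close>
  have split: "{..<2 * n + 1} - {n} = {..<n} \<union> (\<lambda>i. n + 1 + i) ` {..<n}"
  proof (intro equalityI subsetI)
    fix l assume "l \<in> {..<2 * n + 1} - {n}"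
    hence "l < n \<or> (l - (n + 1) < n \<and> l = n + 1 + (l - (n + 1)))" by auto
    thus "l \<in> {..<n} \<union> (\<lambda>i. n + 1 + i) ` {..<n}" by blast
  qed auto
  have "R x0 = (\<Prod>i<n. 1 + x0 * q ^ i) * (\<Prod>i\<in>(\<lambda>i. n + 1 + i) ` {..<n}. 1 + x0 * q ^ i)"
    unfolding R_def split by (rule prod.union_disjoint) auto
  also have "(\<Prod>i\<in>(\<lambda>i. n + 1 + i) ` {..<n}. 1 + x0 * q ^ i) = (\<Prod>i<n. 1 + x0 * q ^ (n + 1 + i))"
    by (subst prod.reindex) (auto simp: inj_on_def)
  also have "\<dots> = qfact q n"
    unfolding qfact_def
  proof (rule prod.cong)
    fix i
    have "x0 * q ^ (n + 1 + i) = (x0 * q ^ n) * q ^ Suc i" by (simp add: power_add)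
    thus "1 + x0 * q ^ (n + 1 + i) = 1 - q ^ Suc i" unfolding x0q by simp
  qed simp
  also have "(\<Prod>i<n. 1 + x0 * q ^ i) = (\<Prod>i<n. 1 - inverse q ^ Suc i)"
  proof (rule prod.reindex_bij_witness[of _ "\<lambda>i. n - Suc i" "\<lambda>i. n - Suc i"])
    fix i assume i: "i \<in> {..<n}"
    have "inverse q ^ n = inverse q ^ Suc (n - Suc i) * inverse q ^ i"
      unfolding power_add[symmetric] using i by simp
    hence "inverse q ^ n * q ^ i = inverse q ^ Suc (n - Suc i) * (inverse q ^ i * q ^ i)" by (simp only: mult.assoc)
    also have "inverse q ^ i * q ^ i = 1" using q by (simp add: power_inverse)
    finally show "1 - inverse q ^ Suc (n - Suc i) = 1 + x0 * q ^ i" by (simp add: x0_def)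
  qed auto
  finally have "R x0 * q ^ (n + 1 choose 2) = ((\<Prod>i<n. 1 - inverse q ^ Suc i) * q ^ (n + 1 choose 2)) * qfact q n"
    by (simp only: mult_ac)
  also have "\<dots> = (-1) ^ n * qfact q n ^ 2"
    unfolding prod_one_minus_inverse_power[OF q(2)] by (simp add: power2_eq_square)
  finally show ?thesis using 2 by (simp add: minus_one_power_iff split: if_splits)
qed

text \<open>With s = sqrt r one has r^j = s^j s^j; since j s^j is bounded, a geometric series in s
  dominates.\<close>

lemma summable_linear_times_geometric:
  fixes r :: real
  assumes "0 \<le> r" "r < 1"
  shows "summable (\<lambda>j. (2 * real j + 1) * r ^ j)"
proof -
  define s where "s = sqrt r"
  have s: "norm s < 1" "s \<ge> 0" "s * s = r" using assms by (auto simp: s_def)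
  have "(\<lambda>j. real j * s ^ j) \<longlonglongrightarrow> 0" by (rule powser_times_n_limit_0[OF s(1)])
  hence "Bseq (\<lambda>j. real j * s ^ j)" by (rule convergent_imp_Bseq[OF convergentI])
  then obtain C where C: "\<And>j. norm (real j * s ^ j) \<le> C" unfolding Bseq_def by blast
  have "summable (\<lambda>j. (2 * C + 1) * s ^ j)"
    using s by (intro summable_mult summable_geometric) auto
  thus ?thesis
  proof (rule summable_comparison_test'[where N = 0])
    fix j :: nat
    have "s ^ j \<le> 1" using s by (intro power_le_one) auto
    hence "2 * (real j * s ^ j) + s ^ j \<le> 2 * C + 1" using C[of j] s(2) by simp
    hence "(2 * (real j * s ^ j) + s ^ j) * s ^ j \<le> (2 * C + 1) * s ^ j"
      using s by (intro mult_right_mono) auto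
    moreover have "r ^ j = s ^ j * s ^ j" using s by (simp flip: power_mult_distrib)
    ultimately show "norm ((2 * real j + 1) * r ^ j) \<le> (2 * C + 1) * s ^ j"
      using s by (simp add: abs_mult algebra_simps)
  qed
qed

lemma le_Suc_choose_2: "j \<le> (j + 1 choose 2)"
  by (induction j) (auto simp: choose_2_Suc)

text \<open>The product converges because the powers of q are absolutely summable, and without zero
  factors its value is nonzero. This permits division by the limit.\<close>

lemma qfact_LIMSEQ:
  assumes q: "norm q < 1"
  shows "qfact q \<longlonglongrightarrow> (\<Prod>n. 1 - q ^ Suc n)" and "(\<Prod>n. 1 - q ^ Suc n) \<noteq> 0"
proof -
  have "summable (\<lambda>n. norm (- (q ^ Suc n)))"
    using q by (simp add: norm_power norm_mult summable_mult summable_geometric)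
  hence c: "convergent_prod (\<lambda>n. 1 + - (q ^ Suc n))"
    by (rule summable_imp_convergent_prod_complex) (metis one_minus_power_neq_0[OF q] diff_self diff_minus_eq_add minus_minus)
  hence c: "convergent_prod (\<lambda>n. 1 - q ^ Suc n)" by simp
  show "(\<Prod>n. 1 - q ^ Suc n) \<noteq> 0"
    by (rule prodinf_nonzero[OF c one_minus_power_neq_0[OF q]])
  have "(\<lambda>n. qfact q (Suc n)) \<longlonglongrightarrow> (\<Prod>n. 1 - q ^ Suc n)"
    using convergent_prod_LIMSEQ[OF c] by (simp only: qfact_def lessThan_Suc_atMost)
  thus "qfact q \<longlonglongrightarrow> (\<Prod>n. 1 - q ^ Suc n)"
    by (rule LIMSEQ_imp_Suc)
qed

text \<open>Let n tend to infinity in \<open>jacobi_finite\<close>. The Gaussian binomial of 2 n + 1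
  over n - j tends to P / (P P), so Tannery's theorem gives P^2 = (sum of \<open>b j\<close>) /
  P.\<close>

theorem jacobi_euler_cube:
  fixes q :: complex
  assumes q: "norm q < 1" "q \<noteq> 0"
  shows "summable (\<lambda>j. norm ((-1) ^ j * (2 * of_nat j + 1) * q ^ (j + 1 choose 2)))"
    and "(\<Prod>n. 1 - q ^ Suc n) ^ 3 = (\<Sum>j. (-1) ^ j * (2 * of_nat j + 1) * q ^ (j + 1 choose 2))"
proof -
  define P where "P = (\<Prod>n. 1 - q ^ Suc n)"
  note P = qfact_LIMSEQ[OF q(1), folded P_def]
  define b where "b j = (-1) ^ j * (2 * of_nat j + 1) * q ^ (j + 1 choose 2)" for j
  define a where "a j n = (if j \<le> n then b j * qbinomial q (2 * n + 1) (n - j) else 0)" for j n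
  have normb: "norm (b j) \<le> (2 * real j + 1) * norm q ^ j" for j
  proof -
    have "norm (2 * of_nat j + 1 :: complex) = 2 * real j + 1"
      by (metis norm_of_nat of_nat_Suc of_nat_mult of_nat_numeral add.commute)
    thus ?thesis using q le_Suc_choose_2[of j]
      by (auto simp: b_def norm_mult norm_power intro!: mult_left_mono power_decreasing)
  qed
  have sg: "summable (\<lambda>j. (2 * real j + 1) * norm q ^ j)"
    using q by (intro summable_linear_times_geometric) auto
  show "summable (\<lambda>j. norm ((-1) ^ j * (2 * of_nat j + 1) * q ^ (j + 1 choose 2)))"
    unfolding b_def[symmetric] by (rule summable_comparison_test'[OF sg, where N = 0]) (use normb in auto)
  \<comment> \<open>Convergence of \<open>qfact\<close> to a nonzero limit bounds it and its
    inverse, which gives a majorant independent of n.\<close>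
  obtain U where U: "\<And>n. norm (qfact q n) \<le> U" "U > 0"
    using convergent_imp_Bseq[OF convergentI[OF P(1)]] unfolding Bseq_def by blast
  obtain V where V: "\<And>n. norm (inverse (qfact q n)) \<le> V" "V > 0"
    using convergent_imp_Bseq[OF convergentI[OF tendsto_inverse[OF P]]] unfolding Bseq_def by blast
  have bound: "norm (a j n) \<le> (2 * real j + 1) * norm q ^ j * (U * (V * V))" for j n
  proof (cases "j \<le> n")
    case True
    have "norm (qbinomial q (2 * n + 1) (n - j)) =
       norm (qfact q (2 * n + 1)) * (norm (inverse (qfact q (n - j))) * norm (inverse (qfact q (2 * n + 1 - (n - j)))))"
      by (simp add: qbinomial_def norm_mult norm_divide norm_inverse divide_simps)
    also have "\<dots> \<le> U * (V * V)"
      using U V by (intro mult_mono mult_nonneg_nonneg) (auto simp: less_imp_le)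
    finally show ?thesis using True normb[of j]
      by (auto simp: a_def norm_mult intro!: mult_mono)
  qed (use U V in \<open>simp add: a_def\<close>)
  have lim: "(\<lambda>n. a j n) \<longlonglongrightarrow> b j * (P / (P * P))" for j
  proof (rule Lim_transform_eventually)
    have "filterlim (\<lambda>n::nat. 2 * n + 1) at_top at_top" "filterlim (\<lambda>n. n - j) at_top at_top"
      "filterlim (\<lambda>n. n + 1 + j) at_top at_top"
      by (auto simp: filterlim_at_top eventually_at_top_linorder)
         (metis add_leD2 le_add2 mult_2 le_SucI le_trans add_le_mono, metis le_diff_conv2 add_leD2, metis trans_le_add1 le_SucI)
    hence "(\<lambda>n. qfact q (2 * n + 1)) \<longlonglongrightarrow> P" "(\<lambda>n. qfact q (n - j)) \<longlonglongrightarrow> P"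
      "(\<lambda>n. qfact q (n + 1 + j)) \<longlonglongrightarrow> P"
      by (auto intro: filterlim_compose[OF P(1)])
    thus "(\<lambda>n. b j * (qfact q (2 * n + 1) / (qfact q (n - j) * qfact q (n + 1 + j)))) \<longlonglongrightarrow> b j * (P / (P * P))"
      using P(2) by (intro tendsto_intros) auto
    show "\<forall>\<^sub>F n in sequentially. b j * (qfact q (2 * n + 1) / (qfact q (n - j) * qfact q (n + 1 + j))) = a j n"
      using eventually_ge_at_top[of j]
    proof eventually_elim
      case (elim n)
      hence "2 * n + 1 - (n - j) = n + 1 + j" by simp
      thus ?case using elim by (simp add: a_def qbinomial_def)
    qed
  qed
  have "(\<lambda>n. \<Sum>j. a j n) \<longlonglongrightarrow> (\<Sum>j. b j * (P / (P * P)))"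
    using tannerys_theorem[of a "\<lambda>j. b j * (P / (P * P))" sequentially
      "\<lambda>j. (2 * real j + 1) * norm q ^ j * (U * (V * V))", OF lim _ summable_mult2[OF sg]] bound
    by (simp only: case_prod_unfold eventually_True sequentially_bot simp_thms)
  moreover have "(\<Sum>j. a j n) = qfact q n ^ 2" for n
  proof -
    have "(\<Sum>j. a j n) = (\<Sum>j\<le>n. a j n)"
      by (rule suminf_finite) (auto simp: a_def)
    also have "\<dots> = qfact q n ^ 2"
      unfolding jacobi_finite[OF q] by (intro sum.cong) (auto simp: a_def b_def)
    finally show ?thesis .
  qed
  ultimately have "(\<lambda>n. qfact q n ^ 2) \<longlonglongrightarrow> (\<Sum>j. b j * (P / (P * P)))" by simp
  moreover have "(\<lambda>n. qfact q n ^ 2) \<longlonglongrightarrow> P ^ 2" by (intro tendsto_intros P)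
  ultimately have "P ^ 2 = (\<Sum>j. b j * (P / (P * P)))" using LIMSEQ_unique by blast
  also have "\<dots> = (\<Sum>j. b j) * (P / (P * P))"
    by (rule suminf_mult2[symmetric])
       (rule summable_norm_cancel, rule summable_comparison_test'[OF sg, where N = 0], use normb in auto)
  finally have "P ^ 3 = (\<Sum>j. b j)"
    using P(2) by (simp add: power2_eq_square power3_eq_cube field_simps)
  thus "(\<Prod>n. 1 - q ^ Suc n) ^ 3 = (\<Sum>j. (-1) ^ j * (2 * of_nat j + 1) * q ^ (j + 1 choose 2))"
    by (simp only: P_def b_def)
qed

section \<open>The cube of the eta function as a series over the odd integers\<close>

lemma minus_one_powi: "(-1 :: complex) powi n = (if even n then 1 else -1)"
  by (simp add: power_int_minus_left)

lemma qpow_mult_of_nat: "qpow (of_nat n * w) x = qpow w (real n * x)"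
  by (simp add: qpow_def mult_ac)

lemma qpow_power: "qpow \<tau> x ^ n = qpow \<tau> (real n * x)"
  by (simp add: qpow_def exp_of_nat_mult [symmetric] mult_ac)

lemma real_Suc_choose_2: "real (j + 1 choose 2) = real j * (real j + 1) / 2"
proof (induction j)
  case (Suc j)
  show ?case using Suc.IH choose_2_Suc[of "j + 1"] by (simp add: field_simps)
qed (simp add: numeral_2_eq_2)

text \<open>The exponent is 1/8 + j (j + 1) / 2 = (2 j + 1)^2 / 8. Each Jacobi term is shared
  equally between N = 2 j + 1 and N = - (2 j + 1), hence the 1/2; passing to -N reverses both N and
  the sign factor. This is the form required by \<open>has_sum_iterated_integral\<close>.\<close>

lemma dedekind_eta_cube:
  assumes "Im \<tau> > 0"
  shows "dedekind_eta \<tau> ^ 3 = (\<Sum>\<^sub>\<infinity>N\<in>range (\<lambda>l. 2 * l + 1).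
    (1 / 2 * (-1) powi ((N - 1) div 2)) * of_int N * qpow \<tau> (1 / 8 * (of_int N)\<^sup>2))"
proof -
  define q where "q = qpow \<tau> 1"
  have q: "norm q < 1" "q \<noteq> 0"
    using assms by (simp add: q_def norm_qpow, simp add: q_def qpow_def)
  define b where "b j = qpow \<tau> (1 / 8) * ((-1) ^ j * (2 * of_nat j + 1) * q ^ (j + 1 choose 2))" for j
  define F where "F N = (1 / 2 * (-1) powi ((N - 1) div 2)) * of_int N * qpow \<tau> (1 / 8 * (of_int N)\<^sup>2)" for N
  note J = jacobi_euler_cube[OF q]
  have "dedekind_eta \<tau> ^ 3 = qpow \<tau> (1 / 8) * (\<Prod>n. 1 - q ^ Suc n) ^ 3"
    by (simp add: dedekind_eta_def power_mult_distrib qpow_power q_def)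
  also have "\<dots> = (\<Sum>j. b j)"
    unfolding J(2) b_def using suminf_mult[OF summable_norm_cancel[OF J(1)]] by (rule sym)
  finally have eta: "dedekind_eta \<tau> ^ 3 = (\<Sum>j. b j)" .
  have sn: "summable (\<lambda>j. norm (b j))"
    unfolding b_def norm_mult[of "qpow \<tau> (1 / 8)"] by (rule summable_mult[OF J(1)])
  have b: "(b has_sum dedekind_eta \<tau> ^ 3) UNIV"
    unfolding eta by (rule norm_summable_imp_has_sum[OF sn summable_sums[OF summable_norm_cancel[OF sn]]])
  have b_eq: "b j = (-1) ^ j * (2 * of_nat j + 1) * qpow \<tau> (1 / 8 * (2 * real j + 1)\<^sup>2)" for j
  proof -
    have "1 / 8 * (2 * real j + 1)\<^sup>2 = 1 / 8 + real (j + 1 choose 2) * 1"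
      unfolding real_Suc_choose_2 by (simp add: power2_eq_square field_simps)
    thus ?thesis unfolding b_def q_def qpow_power by (simp only: qpow_add mult_ac)
  qed
  define p m where "p j = 2 * int j + 1" and "m j = - (2 * int j + 1)" for j
  have "F (p j) = 1 / 2 * b j" for j
    unfolding F_def p_def b_eq by simp
  hence "((\<lambda>j. F (p j)) has_sum 1 / 2 * dedekind_eta \<tau> ^ 3) UNIV"
    using has_sum_cmult_right[OF b, of "1 / 2"] by presburger
  hence Fp: "(F has_sum 1 / 2 * dedekind_eta \<tau> ^ 3) (range p)"
    by (subst has_sum_reindex) (auto simp: inj_on_def p_def o_def)
  have "F (m j) = 1 / 2 * b j" for j
  proof -
    have "(m j - 1) div 2 = - int j - 1" by (simp add: m_def)
    hence s: "(-1 :: complex) powi ((m j - 1) div 2) = - ((-1) ^ j)"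
      by (simp add: minus_one_powi minus_one_power_iff)
    have "(real_of_int (m j))\<^sup>2 = (2 * real j + 1)\<^sup>2" by (simp add: m_def power2_eq_square algebra_simps)
    thus ?thesis unfolding F_def b_eq s by (simp add: m_def algebra_simps)
  qed
  hence "((\<lambda>j. F (m j)) has_sum 1 / 2 * dedekind_eta \<tau> ^ 3) UNIV"
    using has_sum_cmult_right[OF b, of "1 / 2"] by presburger
  hence Fm: "(F has_sum 1 / 2 * dedekind_eta \<tau> ^ 3) (range m)"
    by (subst has_sum_reindex) (auto simp: inj_on_def m_def o_def)
  have "(F has_sum 1 / 2 * dedekind_eta \<tau> ^ 3 + 1 / 2 * dedekind_eta \<tau> ^ 3) (range p \<union> range m)"
    by (rule has_sum_Un_disjoint[OF Fp Fm]) (auto simp: p_def m_def)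
  also have "range p \<union> range m = range (\<lambda>l. 2 * l + 1)"
  proof (intro equalityI subsetI)
    fix N :: int assume "N \<in> range (\<lambda>l. 2 * l + 1)"
    then obtain l where N: "N = 2 * l + 1" by blast
    show "N \<in> range p \<union> range m"
    proof (cases "l \<ge> 0")
      case True
      hence "N = p (nat l)" by (simp add: p_def N)
      thus ?thesis by blast
    next
      case False
      hence "N = m (nat (- l - 1))" by (simp add: m_def N)
      thus ?thesis by blast
    qed
  next
    fix N assume "N \<in> range p \<union> range m"
    then obtain j where "N = 2 * int j + 1 \<or> N = 2 * (- int j - 1) + 1" by (auto simp: p_def m_def)
    thus "N \<in> range (\<lambda>l. 2 * l + 1)" by blast
  qed
  finally show ?thesis unfolding F_def by (simp add: infsumI)
qed

subsection \<open>The false theta function\<close>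

text \<open>The index N = 2 m n is integral: the weight n becomes N / (2 m) and the exponent m n^2
  becomes N^2 / (4 m), as \<open>has_sum_iterated_integral\<close> requires.\<close>

lemma theta1_eq:
  assumes "m > 0"
  shows "theta1 m r w = (\<Sum>\<^sub>\<infinity>N\<in>range (\<lambda>l. 2 * int m * l + r).
    of_real (1 / (2 * real m)) * of_int N * qpow w (1 / (4 * real m) * (of_int N)\<^sup>2))"
proof -
  have i1: "inj (\<lambda>l::int. real_of_int l + real_of_int r / (2 * real m))" by (auto simp: inj_on_def)
  have i2: "inj (\<lambda>l::int. 2 * int m * l + r)" using assms by (auto simp: inj_on_def)
  have "real_of_int l + real_of_int r / (2 * real m) = 1 / (2 * real m) * real_of_int (2 * int m * l + r)" for l
    using assms by (simp add: field_simps)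
  moreover have "real m * (1 / (2 * real m) * x)\<^sup>2 = 1 / (4 * real m) * x\<^sup>2" for x
    using assms by (simp add: power2_eq_square field_simps)
  ultimately have "of_real (real_of_int l + real_of_int r / (2 * real m)) *
      qpow w (real m * (real_of_int l + real_of_int r / (2 * real m))\<^sup>2) =
      of_real (1 / (2 * real m)) * of_int (2 * int m * l + r) *
      qpow w (1 / (4 * real m) * (of_int (2 * int m * l + r))\<^sup>2)" for l
    by (simp only: of_real_mult of_real_of_int_eq)
  thus ?thesis
    unfolding theta1_def infsum_reindex[OF i1] infsum_reindex[OF i2] o_def by presburger
qed

text \<open>Put r = x / y and let d be the arctangent of the first argument minus arctan (1 / s).
  For r \<noteq> 0 the second argument is the cotangent of d, so its arctangent is pi/2 - d modulo
  pi. For \<open>x = 0\<close> the second argument is 0 by division by zero and the first is 1 /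
  s.\<close>

lemma arctan_add_eq_sgn:
  fixes s x y :: real
  assumes s: "s > 0" and y: "y \<noteq> 0"
  shows "arctan ((x + y) / (s * y)) + arctan ((x + (s\<^sup>2 + 1) * y) / (s * x)) =
    pi / 2 * (sgn x * sgn y) + arctan (1 / s)"
proof (cases "x = 0")
  case False
  define r where "r = x / y"
  have r: "r \<noteq> 0" "x = r * y" using False y by (auto simp: r_def)
  define u where "u = (r + 1) / s"
  define v where "v = (r + s\<^sup>2 + 1) / (s * r)"
  define d where "d = arctan u - arctan (1 / s)"
  have u: "(x + y) / (s * y) = u" and v: "(x + (s\<^sup>2 + 1) * y) / (s * x) = v"
    using y r s by (simp_all add: u_def v_def field_simps)
  have sg: "sgn x * sgn y = sgn r" using y r by (auto simp: sgn_if zero_less_mult_iff)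
  have sc: "sin (arctan z) = z * cos (arctan z)" for z
    using tan_arctan[of z] by (simp add: tan_def field_simps)
  \<comment> \<open>Since sin (arctan z) = z cos (arctan z), both cos d and sin d carry the factor
    \<open>C\<close>, which cancels in the quotient.\<close>
  define C where "C = cos (arctan u) * cos (arctan (1 / s))"
  have C: "C \<noteq> 0" by (simp add: C_def)
  have cosd: "cos d = C * (1 + u / s)" and sind: "sin d = C * (u - 1 / s)"
    unfolding d_def cos_diff sin_diff sc C_def by (simp_all add: algebra_simps)
  have us: "u - 1 / s = r / s" using s by (simp add: u_def field_simps)
  have vv: "cos d / sin d = v"
    unfolding cosd sind us using C s r by (simp add: u_def v_def field_simps power2_eq_square)
  have b: "0 < arctan (1 / s)" "arctan (1 / s) < pi / 2" "arctan u < pi / 2" "- (pi / 2) < arctan u"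
    using s arctan_ubound[of "1 / s"] arctan_ubound[of u] arctan_lbound[of u] by simp_all
  \<comment> \<open>The sign of d is that of r and |d| < pi; accordingly pi/2 - d or -pi/2 - d is
    the representative in the range of arctan.\<close>
  have "arctan v = pi / 2 * sgn r - d"
  proof (cases "r > 0")
    case True
    hence "d > 0" using us s by (simp add: d_def arctan_less_iff) (smt (verit) divide_pos_pos)
    moreover have "tan (pi / 2 - d) = v" using vv by (simp add: tan_def sin_diff cos_diff)
    moreover have "d < pi" using b(1,3) pi_gt_zero unfolding d_def by linarith
    ultimately show ?thesis using True by (intro arctan_unique) simp_all
  next
    case F: False
    hence "d < 0" using us s r by (simp add: d_def arctan_less_iff) (smt (verit) divide_neg_pos)
    moreover have "tan (- (pi / 2) - d) = v" using vv by (simp add: tan_def sin_diff cos_diff)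
    moreover have "- pi < d" using b(2,4) unfolding d_def by linarith
    ultimately show ?thesis using F r by (intro arctan_unique) simp_all
  qed
  thus ?thesis unfolding u v sg d_def by simp
qed (use assms in simp)

lemma summable_shifted_gaussian:
  assumes "Im \<tau> > 0" "c > 0"
  shows "(\<lambda>l::int. norm ((-1) powi l * qpow \<tau> (c * (of_int l + 1/2)\<^sup>2))) summable_on UNIV"
proof -
  \<comment> \<open>Writing l + 1/2 = (2 l + 1) / 2 reduces the sum to odd integers and accounts for
    the divisor 4.\<close>
  define C where "C = 2 * pi * Im \<tau> * c / 4"
  have "C > 0" using assms by (simp add: C_def)
  hence "(\<lambda>N::int. exp (- C * (real_of_int N)\<^sup>2)) summable_on range (\<lambda>l. 2 * l + 1)"
    by (intro summable_on_subset[OF summable_gaussian(2)]) auto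
  moreover have "inj (\<lambda>l::int. 2 * l + 1)" by (auto simp: inj_on_def)
  ultimately have "(\<lambda>l::int. exp (- C * (real_of_int (2 * l + 1))\<^sup>2)) summable_on UNIV"
    by (simp only: summable_on_reindex o_def)
  also have "(\<lambda>l::int. exp (- C * (real_of_int (2 * l + 1))\<^sup>2)) =
     (\<lambda>l. norm ((-1) powi l * qpow \<tau> (c * (of_int l + 1/2)\<^sup>2)))"
    by (simp add: fun_eq_iff norm_mult norm_power_int norm_qpow C_def power2_eq_square field_simps)
  finally show ?thesis .
qed

text \<open>The involution taking l to -l - 1 preserves (l + 1/2)^2 and reverses the sign, so the
  sum is its own negative.\<close>

lemma infsum_alternating_shifted:
  "(\<Sum>\<^sub>\<infinity>l::int. (-1) powi l * qpow \<tau> (c * (of_int l + 1/2)\<^sup>2)) = 0"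
proof -
  let ?B = "\<lambda>l::int. (-1) powi l * qpow \<tau> (c * (of_int l + 1/2)\<^sup>2)"
  have bij: "bij (\<lambda>l::int. - l - 1)" by (rule bij_betwI[of _ _ _ "\<lambda>l. - l - 1"]) auto
  have "?B (- l - 1) = - ?B l" for l
  proof -
    have "(real_of_int (- l - 1) + 1/2)\<^sup>2 = (real_of_int l + 1/2)\<^sup>2" by (simp add: power2_eq_square algebra_simps)
    thus ?thesis by (simp add: minus_one_powi)
  qed
  hence "infsum ?B UNIV = (\<Sum>\<^sub>\<infinity>l. - ?B l)"
    using infsum_reindex_bij_betw[OF bij, of ?B] by simp
  thus ?thesis by (simp add: infsum_uminus)
qed

theorem proposition7p2:
  fixes k :: nat and \<tau> :: complex
  assumes "Im \<tau> > 0"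
  shows "2 * FF k \<tau> / of_real (sqrt (2 * real k + 1)) =
    iterated_integral (\<lambda>w1. dedekind_eta ((2 * of_nat k + 1) * w1) ^ 3)
                      (\<lambda>w2. dedekind_eta w2 ^ 3) \<tau>
    + 2 * (of_nat k + 1) * (\<Sum>j = 0..2 * k + 1. (-1) ^ j *
        iterated_integral (\<lambda>w1. theta1 (k + 1) (int j) ((2 * of_nat k + 1) * w1))
                          (\<lambda>w2. theta1 (k + 1) (int j + int k + 1) w2) \<tau>)"
proof -
  define s where "s = sqrt (2 * real k + 1)"
  have s: "s > 0" "s\<^sup>2 = 2 * real k + 1" "sqrt (s\<^sup>2) = s" by (auto simp: s_def)
  \<comment> \<open>The pair (n, l) stands for n1 = n and n2 = l + 1/2; \<open>Q\<close> is then the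
    exponent in \<open>FF\<close>.\<close>
  define Q where "Q n l = (real_of_int n)\<^sup>2 / 2 + real_of_int n * (real_of_int l + 1/2) +
    (real k + 1) * (real_of_int l + 1/2)\<^sup>2" for n l
  define D where "D = (\<lambda>(n, l). (-1) powi n * qpow \<tau> (Q n l))"
  \<comment> \<open>The common shape to which both kinds of integrals reduce, with the same weight 2
    / (pi s).\<close>
  define G where "G y z = (\<lambda>(n :: int, l :: int).
    of_real (2 / (pi * s) * arctan (y n l / (s * z n l))) * D (n, l))" for y z :: "int \<Rightarrow> int \<Rightarrow> real"
  have w: "2 * of_nat k + 1 = (of_nat (2 * k + 1) :: complex)" by simp
  have Imw: "Im (of_nat (2 * k + 1) * w) > 0" if "Im w > 0" for w
    using that by (simp add: add_pos_nonneg)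
  have sgn1: "norm ((-1 :: complex) powi n) = 1" for n by (simp add: norm_power_int)

  \<comment> \<open>The eta integral as a sum over the index set of \<open>FF\<close>\<close>
  define I1 where "I1 = iterated_integral (\<lambda>w1. dedekind_eta ((2 * of_nat k + 1) * w1) ^ 3)
    (\<lambda>w2. dedekind_eta w2 ^ 3) \<tau>"
  define \<gamma> :: "int \<Rightarrow> complex" where "\<gamma> N = 1 / 2 * (-1) powi ((N - 1) div 2)" for N
  \<comment> \<open>Evaluation at (2 k + 1) w1 multiplies the exponents N^2 / 8 by 2 k + 1.\<close>
  define c1 where "c1 = real (2 * k + 1) * (1 / 8)"
  have c1: "c1 = s\<^sup>2 / 8" unfolding c1_def s by simp
  have "((\<lambda>(N, M). \<gamma> N * \<gamma> M * of_real (1 / (pi * sqrt (c1 * (1 / 8))) * arctan (sqrt (1 / 8 / c1) * of_int M / of_int N)) *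
      qpow \<tau> (c1 * (of_int N)\<^sup>2 + 1 / 8 * (of_int M)\<^sup>2)) has_sum I1) (range (\<lambda>l. 2 * l + 1) \<times> range (\<lambda>l. 2 * l + 1))"
    unfolding I1_def w
  proof (rule has_sum_iterated_integral[OF assms])
    show "dedekind_eta (of_nat (2 * k + 1) * w) ^ 3 = (\<Sum>\<^sub>\<infinity>N\<in>range (\<lambda>l. 2 * l + 1). \<gamma> N * of_int N * qpow w (c1 * (of_int N)\<^sup>2))"
      if "Im w > 0" for w
      unfolding dedekind_eta_cube[OF Imw[OF that]] qpow_mult_of_nat c1_def \<gamma>_def by (simp only: mult.assoc)
    show "dedekind_eta w ^ 3 = (\<Sum>\<^sub>\<infinity>N\<in>range (\<lambda>l. 2 * l + 1). \<gamma> N * of_int N * qpow w (1 / 8 * (of_int N)\<^sup>2))"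
      if "Im w > 0" for w
      unfolding dedekind_eta_cube[OF that] \<gamma>_def ..
  qed (simp_all add: c1_def \<gamma>_def norm_mult sgn1)
  \<comment> \<open>The change of variables N = 2 n2, M = 2 (n1 + n2) diagonalises the form: (2 k +
    1) N^2 / 8 + M^2 / 8 is \<open>Q\<close>.\<close>
  also have "?this \<longleftrightarrow> (G (\<lambda>n l. of_int n + (of_int l + 1/2)) (\<lambda>n l. of_int l + 1/2) has_sum I1) UNIV"
  proof (rule has_sum_reindex_bij_witness[symmetric, where i = "\<lambda>(N, M). ((M - N) div 2, (N - 1) div 2)"
      and j = "\<lambda>(n, l). (2 * l + 1, 2 * (n + l) + 1)"])
    fix p :: "int \<times> int"
    obtain n l where p: "p = (n, l)" by (cases p)
    define N M where "N = 2 * l + 1" and "M = 2 * (n + l) + 1"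
    \<comment> \<open>The two sign exponents are l and n + l, whose sum has the parity of n.\<close>
    have chi: "\<gamma> N * \<gamma> M = 1 / 4 * (-1) powi n"
      by (simp add: \<gamma>_def N_def M_def minus_one_powi)
    have rt: "1 / (pi * sqrt (c1 * (1 / 8))) = 8 / (pi * s)" "sqrt (1 / 8 / c1) = 1 / s"
    proof -
      have "c1 * (1 / 8) = (s / 8)\<^sup>2" "1 / 8 / c1 = (1 / s)\<^sup>2"
        unfolding c1 using s(1) by (simp_all add: power2_eq_square)
      thus "1 / (pi * sqrt (c1 * (1 / 8))) = 8 / (pi * s)" "sqrt (1 / 8 / c1) = 1 / s"
        using s(1) by (simp_all only: real_sqrt_abs) simp_all
    qed
    have arg: "1 / s * of_int M / of_int N = (of_int n + (of_int l + 1/2)) / (s * (of_int l + 1/2))"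
    proof -
      have "of_int M = 2 * (of_int n + (of_int l + 1/2) :: real)" "of_int N = 2 * (of_int l + 1/2 :: real)"
        by (simp_all add: M_def N_def)
      moreover have "1 / s * (2 * x) / (2 * z) = x / (s * z)" for x z :: real by simp
      ultimately show ?thesis by (simp only:)
    qed
    have ex: "c1 * (of_int N)\<^sup>2 + 1 / 8 * (of_int M)\<^sup>2 = Q n l"
      unfolding c1 s(2) N_def M_def Q_def by (simp add: power2_eq_square field_simps)
    show "(case (case p of (n, l) \<Rightarrow> (2 * l + 1, 2 * (n + l) + 1)) of (N, M) \<Rightarrow>
        \<gamma> N * \<gamma> M * of_real (1 / (pi * sqrt (c1 * (1 / 8))) * arctan (sqrt (1 / 8 / c1) * of_int M / of_int N)) *
        qpow \<tau> (c1 * (of_int N)\<^sup>2 + 1 / 8 * (of_int M)\<^sup>2)) =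
      G (\<lambda>n l. of_int n + (of_int l + 1/2)) (\<lambda>n l. of_int l + 1/2) p"
      unfolding p prod.case N_def[symmetric] M_def[symmetric] chi rt arg ex G_def D_def by simp
    show "(case p of (n, l) \<Rightarrow> (2 * l + 1, 2 * (n + l) + 1)) \<in> range (\<lambda>l. 2 * l + 1) \<times> range (\<lambda>l. 2 * l + 1)"
      unfolding p prod.case by blast
  qed auto
  finally have S1: "(G (\<lambda>n l. of_int n + (of_int l + 1/2)) (\<lambda>n l. of_int l + 1/2) has_sum I1) UNIV" .

  \<comment> \<open>The theta integrals as one sum over the same index set\<close>
  define I2 where "I2 j = iterated_integral (\<lambda>w1. theta1 (k + 1) (int j) ((2 * of_nat k + 1) * w1))
    (\<lambda>w2. theta1 (k + 1) (int j + int k + 1) w2) \<tau>" for j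
  define m where "m = 2 * int (k + 1)"
  define U V where "U j = range (\<lambda>l. m * l + int j)" and "V j = range (\<lambda>l. m * l + (int j + int k + 1))" for j
  define a where "a = 1 / (2 * real (k + 1))"
  have a: "a = 1 / (s\<^sup>2 + 1)" unfolding s a_def by simp
  define d where "d = 1 / (4 * real (k + 1))"
  have d: "d = a / 2" unfolding d_def a_def by simp
  have a0: "a > 0" by (simp add: a_def)
  define c2 where "c2 = real (2 * k + 1) * d"
  have c2: "c2 = s\<^sup>2 * d" unfolding c2_def s by simp
  have k1: "k + 1 > 0" by simp
  have a1: "norm (complex_of_real a) \<le> 1" unfolding norm_of_real by (simp add: a_def)
  define H where "H = (\<lambda>(N :: int, M :: int). of_real a * of_real a *
     of_real (1 / (pi * sqrt (c2 * d)) * arctan (sqrt (d / c2) * of_int M / of_int N)) *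
     qpow \<tau> (c2 * (of_int N)\<^sup>2 + d * (of_int M)\<^sup>2))"
  have H: "(H has_sum I2 j) (U j \<times> V j)" for j
    unfolding I2_def w H_def
  proof (rule has_sum_iterated_integral[OF assms])
    show "theta1 (k + 1) (int j) (of_nat (2 * k + 1) * w) =
        (\<Sum>\<^sub>\<infinity>N\<in>U j. of_real a * of_int N * qpow w (c2 * (of_int N)\<^sup>2))" for w
      unfolding theta1_eq[OF k1] qpow_mult_of_nat c2_def
        U_def m_def a_def d_def by (simp only: mult.assoc)
    show "theta1 (k + 1) (int j + int k + 1) w =
        (\<Sum>\<^sub>\<infinity>N\<in>V j. of_real a * of_int N * qpow w (d * (of_int N)\<^sup>2))" for w
      unfolding theta1_eq[OF k1]
        V_def m_def a_def d_def ..
  qed (use a1 in \<open>simp_all add: c2_def d_def\<close>)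
  \<comment> \<open>As \<open>m\<close> is even, (-1)^j depends only on N for N in
    \<open>U j\<close>. Writing it as (-1)^N makes the summand independent of j; 1 / a = 2 (k + 1)
    is the prefactor of the theta sum.\<close>
  define H' where "H' = (\<lambda>(N, M). (-1) powi N * (of_real (1 / a) * H (N, M)))"
  have H': "(H' has_sum (-1) ^ j * (of_real (1 / a) * I2 j)) (U j \<times> V j)" for j
  proof -
    have "((\<lambda>p. (-1) ^ j * (of_real (1 / a) * H p)) has_sum (-1) ^ j * (of_real (1 / a) * I2 j)) (U j \<times> V j)"
      by (intro has_sum_cmult_right H)
    also have "?this \<longleftrightarrow> ?thesis"
    proof (rule has_sum_cong)
      fix p assume "p \<in> U j \<times> V j"
      then obtain l M where p: "p = (m * l + int j, M)" by (auto simp: U_def)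
      have "(-1 :: complex) powi (m * l + int j) = (-1) ^ j"
        by (simp add: minus_one_powi minus_one_power_iff m_def)
      thus "(-1) ^ j * (of_real (1 / a) * H p) = H' p" by (simp add: p H'_def)
    qed
    finally show ?thesis .
  qed
  define I where "I = (\<Sum>j = 0..2 * k + 1. (-1) ^ j * (of_real (1 / a) * I2 j))"
  \<comment> \<open>The residue of N modulo \<open>m\<close> recovers j, so the pieces are disjoint
    and the sum over j becomes a single sum over pairs with M - N congruent to k + 1 modulo
    \<open>m\<close>.\<close>
  have "(H' has_sum I) (\<Union>j\<in>{0..2 * k + 1}. U j \<times> V j)"
    unfolding I_def
  proof (rule sum_has_sum)
    fix i j assume ij: "i \<in> {0..2 * k + 1}" "j \<in> {0..2 * k + 1}" "i \<noteq> j"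
    have Um: "N mod m = int i" if "N \<in> U i" "i \<in> {0..2 * k + 1}" for i N
      using that by (auto simp: U_def m_def)
    show "(U i \<times> V i) \<inter> (U j \<times> V j) = {}"
      using Um[OF _ ij(1)] Um[OF _ ij(2)] ij(3) by fastforce
  qed (use H' in auto)
  \<comment> \<open>Here the change of variables is N = n1, M = n1 + 2 (k + 1) n2.\<close>
  also have "?this \<longleftrightarrow> (G (\<lambda>n l. of_int n + (s\<^sup>2 + 1) * (of_int l + 1/2)) (\<lambda>n l. of_int n) has_sum I) UNIV"
  proof (rule has_sum_reindex_bij_witness[symmetric, where i = "\<lambda>(N, M). (N, (M - N) div m)"
      and j = "\<lambda>(n, l). (n, n + m * l + (int k + 1))"])
    fix p :: "int \<times> int"
    obtain n l where p: "p = (n, l)" by (cases p)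
    \<comment> \<open>The offset k + 1 lies strictly between 0 and \<open>m\<close>, so integer
      division discards it and recovers l.\<close>
    have "(int k + 1) div m = 0" by (auto simp: m_def)
    thus "(case (case p of (n, l) \<Rightarrow> (n, n + m * l + (int k + 1))) of (N, M) \<Rightarrow> (N, (M - N) div m)) = p"
      by (simp add: p m_def)
    have "n = m * (n div m) + int (nat (n mod m))" "nat (n mod m) \<in> {0..2 * k + 1}"
    proof -
      have "m > 0" by (simp add: m_def)
      hence r: "0 \<le> n mod m" "n mod m < m" by simp_all
      thus "n = m * (n div m) + int (nat (n mod m))" by simp
      have "m = int (2 * k + 1) + 1" by (simp add: m_def)
      hence "n mod m \<le> int (2 * k + 1)" using r(2) by linarith
      thus "nat (n mod m) \<in> {0..2 * k + 1}" using r unfolding atLeastAtMost_iff by linarith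
    qed
    moreover from this(1) have "n + m * l + (int k + 1) = m * (n div m + l) + (int (nat (n mod m)) + int k + 1)"
      by (simp add: distrib_left)
    ultimately show "(case p of (n, l) \<Rightarrow> (n, n + m * l + (int k + 1))) \<in> (\<Union>j\<in>{0..2 * k + 1}. U j \<times> V j)"
      unfolding p prod.case U_def V_def by blast
    define M where "M = n + m * l + (int k + 1)"
    have M: "of_int M = of_int n + (s\<^sup>2 + 1) * (of_int l + 1/2 :: real)"
      unfolding M_def m_def s by (simp add: field_simps)
    have rt: "sqrt (c2 * d) = s * d" "sqrt (d / c2) = 1 / s"
    proof -
      have "c2 * d = (s * d)\<^sup>2" "d / c2 = (1 / s)\<^sup>2"
        unfolding c2 d using s(1) a0 by (simp_all add: power2_eq_square)
      moreover have "s * d \<ge> 0" using s a0 by (simp add: d)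
      ultimately show "sqrt (c2 * d) = s * d" "sqrt (d / c2) = 1 / s"
        using s(1) by (simp_all only: real_sqrt_abs) simp_all
    qed
    have arg: "1 / s * of_int M / of_int n = of_int M / (s * of_int n)" by simp
    \<comment> \<open>With S = s^2 + 1 = 2 (k + 1) this is the second diagonalisation of the form:
      ((S - 1) x^2 + (x + S y)^2) / (2 S) = x^2 / 2 + x y + S y^2 / 2.\<close>
    have ex: "c2 * (of_int n)\<^sup>2 + d * (of_int M)\<^sup>2 = Q n l"
    proof -
      have "Q n l = (of_int n)\<^sup>2 / 2 + of_int n * (of_int l + 1/2) + (s\<^sup>2 + 1) / 2 * (of_int l + 1/2)\<^sup>2"
        unfolding s Q_def by simp
      moreover have "(S - 1) * (1 / S / 2) * x\<^sup>2 + 1 / S / 2 * (x + S * y)\<^sup>2 = x\<^sup>2 / 2 + x * y + S / 2 * y\<^sup>2"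
        if "S \<noteq> 0" for S x y :: real
        using that by (simp add: power2_eq_square field_simps)
      moreover have "s\<^sup>2 + 1 \<noteq> 0" unfolding s by simp
      ultimately show ?thesis unfolding c2 d M a by (metis add_diff_cancel_right')
    qed
    have co: "of_real (1 / a) * (of_real a * of_real a * of_real (1 / (pi * (s * d)) * x)) = complex_of_real (2 / (pi * s) * x)" for x
      unfolding of_real_mult[symmetric] of_real_eq_iff d using a0 by simp
    have "H' (n, M) = (-1) powi n * (of_real (1 / a) * (of_real a * of_real a *
        of_real (1 / (pi * (s * d)) * arctan (of_int M / (s * of_int n)))) * qpow \<tau> (Q n l))"
      unfolding H'_def H_def prod.case rt arg ex by (simp only: mult.assoc)
    also have "\<dots> = G (\<lambda>n l. of_int n + (s\<^sup>2 + 1) * (of_int l + 1/2)) (\<lambda>n l. of_int n) p"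
      unfolding co M G_def D_def p prod.case by (simp only: mult_ac)
    finally show "H' (case p of (n, l) \<Rightarrow> (n, n + m * l + (int k + 1))) =
        G (\<lambda>n l. of_int n + (s\<^sup>2 + 1) * (of_int l + 1/2)) (\<lambda>n l. of_int n) p"
      unfolding p prod.case M_def .
  next
    fix p assume "p \<in> (\<Union>j\<in>{0..2 * k + 1}. U j \<times> V j)"
    then obtain j x y where p: "p = (m * x + int j, m * y + (int j + int k + 1))"
      by (auto simp: U_def V_def)
    have "(m * y + (int j + int k + 1) - (m * x + int j)) div m = y - x + (int k + 1) div m"
    proof -
      have "m * y + (int j + int k + 1) - (m * x + int j) = (int k + 1) + (y - x) * m" by (simp add: algebra_simps)
      moreover have "m \<noteq> 0" by (simp add: m_def)
      ultimately show ?thesis by (metis div_mult_self1)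
    qed
    also have "(int k + 1) div m = 0" by (auto simp: m_def)
    finally have e: "(m * y + (int j + int k + 1) - (m * x + int j)) div m = y - x" by simp
    show "(case (case p of (N, M) \<Rightarrow> (N, (M - N) div m)) of (n, l) \<Rightarrow> (n, n + m * l + (int k + 1))) = p"
      unfolding p prod.case e by (simp add: algebra_simps)
  qed auto
  finally have S2: "(G (\<lambda>n l. of_int n + (s\<^sup>2 + 1) * (of_int l + 1/2)) (\<lambda>n l. of_int n) has_sum I) UNIV" .

  \<comment> \<open>Vanishing of the sum multiplying the constant arctangent\<close>
  have D0: "(D has_sum 0) UNIV"
  proof -
    let ?A = "\<lambda>l::int. (-1) powi l * qpow \<tau> (s\<^sup>2 / 2 * (of_int l + 1/2)\<^sup>2)"
    let ?B = "\<lambda>l::int. (-1) powi l * qpow \<tau> (1 / 2 * (of_int l + 1/2)\<^sup>2)"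
    have "((\<lambda>(l, r). ?A l * ?B r) has_sum infsum ?A UNIV * infsum ?B UNIV) (UNIV \<times> UNIV)"
      using assms s by (intro has_sum_prod_abs(2) summable_shifted_gaussian) auto
    hence "((\<lambda>(l, r). ?A l * ?B r) has_sum 0) UNIV"
      unfolding infsum_alternating_shifted by simp
    \<comment> \<open>The variable r = n + l separates \<open>D\<close> into a product of two
      alternating series, each with sum 0. The reflection of r to -r - 1 is the involution sending
      n1 to -n1 - 2 n2.\<close>
    also have "?this \<longleftrightarrow> ?thesis"
    proof (rule has_sum_reindex_bij_witness[where i = "\<lambda>(n, l). (l, n + l)" and j = "\<lambda>(l, r). (r - l, l)"])
      fix p :: "int \<times> int"
      obtain l r where p: "p = (l, r)" by (cases p)
      have "s\<^sup>2 / 2 * (of_int l + 1/2)\<^sup>2 + 1 / 2 * (of_int r + 1/2)\<^sup>2 = Q (r - l) l"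
        unfolding s Q_def by (simp add: power2_eq_square field_simps)
      hence "qpow \<tau> (Q (r - l) l) = qpow \<tau> (s\<^sup>2 / 2 * (of_int l + 1/2)\<^sup>2) * qpow \<tau> (1 / 2 * (of_int r + 1/2)\<^sup>2)"
        by (metis qpow_add)
      moreover have "(-1 :: complex) powi (r - l) = (-1) powi l * (-1) powi r"
        by (simp add: minus_one_powi)
      ultimately show "D (case p of (l, r) \<Rightarrow> (r - l, l)) = (case p of (l, r) \<Rightarrow> ?A l * ?B r)"
        unfolding p prod.case D_def by (simp only: mult_ac)
    qed auto
    finally show ?thesis .
  qed

  \<comment> \<open>Combination of the two arctangent sums into \<open>FF\<close>\<close>
  define E where "E = (\<lambda>(n, l). (-1) powi n * of_int (sgn n) * of_real (sgn (of_int l + 1/2)) * qpow \<tau> (Q n l))"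
  \<comment> \<open>Multiplying by s turns the weight 2 / (pi s) into 2 / pi, so that the pi/2 of
    \<open>arctan_add_eq_sgn\<close> becomes 1. The subtracted multiple of \<open>D\<close> removes
    arctan (1 / s) from each term and leaves the total unchanged by \<open>D0\<close>.\<close>
  have "((\<lambda>p. of_real s * (G (\<lambda>n l. of_int n + (of_int l + 1/2)) (\<lambda>n l. of_int l + 1/2) p +
      G (\<lambda>n l. of_int n + (s\<^sup>2 + 1) * (of_int l + 1/2)) (\<lambda>n l. of_int n) p) -
      of_real (2 / pi * arctan (1 / s)) * D p) has_sum
      of_real s * (I1 + I) - of_real (2 / pi * arctan (1 / s)) * 0) UNIV"
    unfolding diff_conv_add_uminus by (intro has_sum_add has_sum_uminusI has_sum_cmult_right S1 S2 D0)
  also have "(\<lambda>p. of_real s * (G (\<lambda>n l. of_int n + (of_int l + 1/2)) (\<lambda>n l. of_int l + 1/2) p +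
      G (\<lambda>n l. of_int n + (s\<^sup>2 + 1) * (of_int l + 1/2)) (\<lambda>n l. of_int n) p) -
      of_real (2 / pi * arctan (1 / s)) * D p) = E"
  proof (rule ext, clarify)
    fix n l :: int
    define y where "y = real_of_int l + 1/2"
    have y: "y \<noteq> 0"
    proof
      assume "y = 0"
      hence "real_of_int (2 * l + 1) = real_of_int 0" by (simp add: y_def)
      hence "2 * l + 1 = 0" unfolding of_int_eq_iff .
      thus False by presburger
    qed
    have "s * (2 / (pi * s) * arctan ((of_int n + y) / (s * y)) + 2 / (pi * s) * arctan ((of_int n + (s\<^sup>2 + 1) * y) / (s * of_int n)))
        - 2 / pi * arctan (1 / s) =
        2 / pi * (arctan ((of_int n + y) / (s * y)) + arctan ((of_int n + (s\<^sup>2 + 1) * y) / (s * of_int n))) - 2 / pi * arctan (1 / s)"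
      using s(1) by (simp add: field_simps)
    also have "\<dots> = sgn (of_int n) * sgn y"
      unfolding arctan_add_eq_sgn[OF s(1) y] by (simp add: field_simps)
    finally have "complex_of_real (s * (2 / (pi * s) * arctan ((of_int n + y) / (s * y)) + 2 / (pi * s) * arctan ((of_int n + (s\<^sup>2 + 1) * y) / (s * of_int n)))
        - 2 / pi * arctan (1 / s)) = of_real (sgn (of_int n) * sgn y)" by (rule arg_cong)
    moreover have "complex_of_real (sgn (of_int n)) = of_int (sgn n)" by (simp add: sgn_if)
    ultimately have e: "of_real s * (of_real (2 / (pi * s) * arctan ((of_int n + y) / (s * y))) +
        of_real (2 / (pi * s) * arctan ((of_int n + (s\<^sup>2 + 1) * y) / (s * of_int n))))
        - of_real (2 / pi * arctan (1 / s)) = of_int (sgn n) * complex_of_real (sgn y)"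
      by (simp only: of_real_diff of_real_mult of_real_add)
    show "of_real s * (G (\<lambda>n l. of_int n + (of_int l + 1/2)) (\<lambda>n l. of_int l + 1/2) (n, l) +
      G (\<lambda>n l. of_int n + (s\<^sup>2 + 1) * (of_int l + 1/2)) (\<lambda>n l. of_int n) (n, l)) -
      of_real (2 / pi * arctan (1 / s)) * D (n, l) = E (n, l)"
      unfolding G_def E_def D_def prod.case y_def[symmetric]
      using arg_cong[OF e, of "\<lambda>x. x * ((-1) powi n * qpow \<tau> (Q n l))"]
      by (simp only: ring_distribs mult_ac)
  qed
  finally have E: "(E has_sum of_real s * (I1 + I)) UNIV" by simp
  have "FF k \<tau> = 1 / 2 * infsum E UNIV"
  proof -
    have inj: "inj (\<lambda>(n, l). (n :: int, real_of_int l + 1/2))" by (auto simp: inj_on_def)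
    have ran: "UNIV \<times> range (\<lambda>l::int. real_of_int l + 1/2) = range (\<lambda>(n, l). (n :: int, real_of_int l + 1/2))"
      by auto
    show ?thesis
      unfolding FF_def E_def Q_def ran infsum_reindex[OF inj]
      by (simp only: o_def case_prod_unfold fst_conv snd_conv)
  qed
  hence "2 * FF k \<tau> = of_real s * (I1 + I)" by (simp only: infsumI[OF E]) simp
  hence "2 * FF k \<tau> / of_real s = I1 + I" using s(1) by simp
  also have "I = 2 * (of_nat k + 1) * (\<Sum>j = 0..2 * k + 1. (-1) ^ j * I2 j)"
  proof -
    have "complex_of_real (1 / a) = 2 * (of_nat k + 1)" by (simp add: a_def)
    thus ?thesis unfolding I_def sum_distrib_left by (simp only: mult_ac)
  qed
  finally show ?thesis unfolding s_def I1_def I2_def .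
qed

end
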